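(* Let $1\le p,q<\infty$, let $\omega$ be a weight on $\mathcal H$, and let $\mu$ be a positive measure on $\mathcal H$. Then the following assertions are equivalent. (a) There is a constant $C_1>0$ such that for any $f\in L^p_\omega(\mathcal H)$ and any $\lambda>0$, $$\mu\left(\{z\in\mathcal H: Mf(z)>\lambda\}\right)\le\frac{C_1}{\lambda^q}\left(\int_{\mathcal H}|f(z)|^p\omega(z)\,dV(z)\right)^{q/p}.$$ (b) There is a constant $C_2>0$ such that for any interval $I\subset\mathbb R$, $$|Q_I|^{-q/p}\left(\frac1{|Q_I|}\int_{Q_I}\omega^{1-p'}(z)\,dV(z)\right)^{q/p'}\mu(Q_I)\le C_2,$$ where $\left(\frac1{|Q_I|}\int_{Q_I}\omega^{1-p'}(z)\,dV(z)\right)^{1/p'}$ is understood as $\left(\inf_{Q_I}\omega\right)^{-1}$ when $p=1$. (c) There exists a constant $C_3>0$ such that for any locally integrable function $f$ and any interval $I\subset\mathbb R$, $$\left(\frac1{|Q_I|}\int_{Q_I}|f(z)|\,dV(z)\right)^q\mu(Q_I)\le C_3\left(\int_{Q_I}|f(z)|^p\omega(z)\,dV(z)\right)^{q/p}.$$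
   Context: $\mathcal H=\{z=x+iy\in\mathbb C: x\in\mathbb R,\ y>0\}$ is the upper half-plane and $dV$ is Lebesgue measure on $\mathcal H$. A weight is a nonnegative locally integrable function on $\mathcal H$. Intervals $I\subset\mathbb R$ are bounded and of positive length $|I|$. For an interval $I$, $Q_I=\{x+iy: x\in I,\ 0<y<|I|\}$ and $|Q_I|=\int_{Q_I}dV$. The exponent $p'$ is defined by $pp'=p+p'$. $L^p_\omega(\mathcal H)$ is the set of functions $f$ on $\mathcal H$ with $\int_{\mathcal H}|f(z)|^p\omega(z)\,dV(z)<\infty$. The (unweighted) Hardy-Littlewood maximal function is $$Mf(z)=\sup_{I\subset\mathbb R\ \text{interval},\ z\in Q_I}\frac1{|Q_I|}\int_{Q_I}|f|\,dV .$$
   Formalization: That (b) or (c) implies (a) is claimed only for p ≤ q, since it is false for q < p (p=2, q=1, ω=1, unit masses at k+i/2); (a)⇒(b) and (b)⇔(c) are kept for all p, q ≥ 1. For p=1 the infimum of ω over Q_I is the essential infimum. *)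

theory Defs
  imports "HOL-Analysis.Analysis"
begin

definition upper_half_plane :: "complex set" where
  "upper_half_plane = {z. Im z > 0}"

text \<open>Bounded intervals of positive length; the endpoints may or may not belong to the interval.\<close>

definition bdd_interval :: "real set \<Rightarrow> bool" where
  "bdd_interval I \<longleftrightarrow> is_interval I \<and> bounded I \<and> measure lebesgue I > 0"

definition carleson_box :: "real set \<Rightarrow> complex set" where
  "carleson_box I = {z. Re z \<in> I \<and> 0 < Im z \<and> Im z < measure lebesgue I}"

text \<open>Real powers of extended nonnegative reals, with \<open>0\<close> and \<open>\<infinity>\<close> exchanged by negative exponents;
  for \<open>0 < x < \<infinity>\<close> this is the usual power. The statement needs the extended values because a
  weight may vanish and integrals may diverge. As usual in measure theory, and as in the type
  \<open>ennreal\<close>, \<open>0 \<cdot> \<infinity> = 0\<close>.\<close>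

definition ennpowr :: "ennreal \<Rightarrow> real \<Rightarrow> ennreal" where
  "ennpowr x a =
     (if a = 0 then 1
      else if x = 0 then (if a > 0 then 0 else \<infinity>)
      else if x = \<infinity> then (if a > 0 then \<infinity> else 0)
      else ennreal (enn2real x powr a))"

text \<open>Local integrability is integrability on the compact subsets of the (open) half-plane; nothing is
  required near the boundary, so integrals over boxes may be infinite.\<close>

definition locally_integrable :: "(complex \<Rightarrow> 'a::euclidean_space) \<Rightarrow> bool" where
  "locally_integrable f \<longleftrightarrow>
     (\<forall>K. compact K \<and> K \<subseteq> upper_half_plane \<longrightarrow> f absolutely_integrable_on K)"

text \<open>Functions on the half-plane are represented by functions on the complex plane whose values
  off the half-plane are irrelevant.\<close>

definition weight :: "(complex \<Rightarrow> real) \<Rightarrow> bool" where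
  "weight \<omega> \<longleftrightarrow> (\<forall>z\<in>upper_half_plane. \<omega> z \<ge> 0) \<and> locally_integrable \<omega>"

definition weighted_Lp :: "real \<Rightarrow> (complex \<Rightarrow> real) \<Rightarrow> (complex \<Rightarrow> complex) set" where
  "weighted_Lp p \<omega> = {f. f \<in> borel_measurable (lebesgue_on upper_half_plane) \<and>
     (\<integral>\<^sup>+z\<in>upper_half_plane. ennreal (norm (f z) powr p * \<omega> z) \<partial>lebesgue) < \<infinity>}"

definition box_average :: "real set \<Rightarrow> (complex \<Rightarrow> ennreal) \<Rightarrow> ennreal" where
  "box_average I g = (\<integral>\<^sup>+z\<in>carleson_box I. g z \<partial>lebesgue) / emeasure lebesgue (carleson_box I)"

definition maximal_fun :: "(complex \<Rightarrow> complex) \<Rightarrow> complex \<Rightarrow> ennreal" where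
  "maximal_fun f z =
     (SUP I\<in>{I. bdd_interval I \<and> z \<in> carleson_box I}. box_average I (\<lambda>w. ennreal (norm (f w))))"

definition conj_exponent :: "real \<Rightarrow> real" where
  "conj_exponent p = p / (p - 1)"

lemma conj_exponent_iff:
  assumes "p > 1"
  shows "p * p' = p + p' \<longleftrightarrow> p' = conj_exponent p"
  using assms by (auto simp: conj_exponent_def field_simps)

text \<open>The infimum of a weight over a box is the essential infimum, since weights are only
  determined up to null sets.\<close>

definition ess_inf :: "'a measure \<Rightarrow> ('a \<Rightarrow> ennreal) \<Rightarrow> ennreal" where
  "ess_inf M g = Sup {c. AE z in M. c \<le> g z}"

definition dual_mean :: "real \<Rightarrow> (complex \<Rightarrow> real) \<Rightarrow> real set \<Rightarrow> ennreal" where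
  "dual_mean p \<omega> I =
     (if p = 1 then inverse (ess_inf (lebesgue_on (carleson_box I)) (\<lambda>z. ennreal (\<omega> z)))
      else ennpowr (box_average I (\<lambda>z. ennpowr (ennreal (\<omega> z)) (1 - conj_exponent p)))
             (1 / conj_exponent p))"

text \<open>For \<open>p \<le> q\<close> the three conditions below are equivalent. The bound on averages and the testing
  condition are equivalent, and implied by the weak type bound, for all \<open>p, q \<ge> 1\<close>, but without
  \<open>p \<le> q\<close> they do not imply it: take \<open>p = 2\<close>, \<open>q = 1\<close>, \<open>\<omega> = 1\<close>, let \<open>\<mu>\<close> consist of unit point masses
  at \<open>k + \<i>/2\<close> for all integers \<open>k\<close>, and let \<open>f\<close> be the indicator function of the rectangle
  \<open>[0,N) \<times> (0,1)\<close> with \<open>N\<close> large.\<close>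

definition weak_type_bound ::
  "real \<Rightarrow> real \<Rightarrow> (complex \<Rightarrow> real) \<Rightarrow> complex measure \<Rightarrow> bool" where
  "weak_type_bound p q \<omega> \<mu> \<longleftrightarrow>
     (\<exists>C>0. \<forall>f\<in>weighted_Lp p \<omega>. \<forall>l>0.
        emeasure \<mu> {z\<in>upper_half_plane. maximal_fun f z > ennreal l} \<le>
        ennreal (C / l powr q) *
        ennpowr (\<integral>\<^sup>+z\<in>upper_half_plane. ennreal (norm (f z) powr p * \<omega> z) \<partial>lebesgue) (q / p))"

definition box_testing_condition ::
  "real \<Rightarrow> real \<Rightarrow> (complex \<Rightarrow> real) \<Rightarrow> complex measure \<Rightarrow> bool" where
  "box_testing_condition p q \<omega> \<mu> \<longleftrightarrow>
     (\<exists>C>0. \<forall>I. bdd_interval I \<longrightarrow>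
        ennpowr (emeasure lebesgue (carleson_box I)) (- (q / p)) * ennpowr (dual_mean p \<omega> I) q *
        emeasure \<mu> (carleson_box I) \<le> ennreal C)"

definition box_average_bound ::
  "real \<Rightarrow> real \<Rightarrow> (complex \<Rightarrow> real) \<Rightarrow> complex measure \<Rightarrow> bool" where
  "box_average_bound p q \<omega> \<mu> \<longleftrightarrow>
     (\<exists>C>0. \<forall>f :: complex \<Rightarrow> complex. locally_integrable f \<longrightarrow> (\<forall>I. bdd_interval I \<longrightarrow>
        ennpowr (box_average I (\<lambda>z. ennreal (norm (f z)))) q * emeasure \<mu> (carleson_box I) \<le>
        ennreal C *
        ennpowr (\<integral>\<^sup>+z\<in>carleson_box I. ennreal (norm (f z) powr p * \<omega> z) \<partial>lebesgue) (q / p)))"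

end

theory Submission
  imports Defs
begin

text \<open>Write \<open>W\<^sub>I\<close> for the integral of \<open>norm f powr p * \<omega>\<close> over the box over \<open>I\<close>. On a single box, Hoelder's inequality for
the pairing of \<open>norm f * \<omega> powr (1 / p)\<close> with \<open>\<omega> powr - (1 / p)\<close> bounds the average of \<open>norm f\<close> by
\<open>W\<^sub>I powr (1 / p)\<close> times the area to the power \<open>- 1 / p\<close> times the dual mean of the weight
(\<open>box_mean_le_dual_mean\<close>), and the dual mean is the best constant in this inequality
(\<open>exists_box_test_function\<close>): for \<open>p > 1\<close> truncations of the extremal function \<open>\<omega> powr (1 - p')\<close> come
arbitrarily close, and for \<open>p = 1\<close> so do the indicators of the sets where \<open>\<omega>\<close> is almost as small as
its essential infimum. The \<open>q\<close>-th power of these two facts, multiplied by the \<open>\<mu>\<close>-measure of the box,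
is the equivalence of the testing condition with the bound on averages. Since the competitors are
bounded, measurable and supported in the box, and since the box lies in the set where the maximal
function exceeds \<open>l\<close> as soon as the average over the box exceeds \<open>l\<close>, the weak type bound gives the
testing condition by the same argument.

For the converse with \<open>p \<le> q\<close>, a superlevel set of the maximal function is a union of boxes over open
intervals on which the average of \<open>norm f\<close> exceeds \<open>l\<close>. By Lindelof's theorem and continuity of \<open>\<mu>\<close>
from below, finitely many of them may be considered, and by Vitali's covering lemma these are covered
by the boxes over five times as long intervals of a disjoint subfamily. The bound on averages over the
large box, applied to \<open>f\<close> restricted to the small box, controls the measure of the large box by the
integral over the small box alone (\<open>measure_dilated_box_le\<close>). The exponent \<open>q / p \<ge> 1\<close> makes the
resulting sum of powers at most the power of the sum (\<open>sum_ennpowr_le\<close>), and disjointness bounds that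
sum by the integral over the half-plane.

The weight may vanish and the integrals may diverge, so everything takes place in \<open>ennreal\<close> with
\<open>0 * \<infinity> = 0\<close>. The one place where this convention would break the estimates is an infinite dual mean
against a zero integral; there the testing condition forces the box to have \<open>\<mu>\<close>-measure \<open>0\<close>.\<close>

section \<open>Real powers of extended nonnegative reals\<close>

lemma ennpowr_ennreal: "0 < x \<Longrightarrow> ennpowr (ennreal x) a = ennreal (x powr a)"
  by (auto simp: ennpowr_def)

lemma ennpowr_ennreal_nonneg: "0 \<le> x \<Longrightarrow> 0 < a \<Longrightarrow> ennpowr (ennreal x) a = ennreal (x powr a)"
  by (auto simp: ennpowr_def ennreal_eq_0_iff)

lemma ennpowr_0 [simp]: "0 < a \<Longrightarrow> ennpowr 0 a = 0"
  and ennpowr_top [simp]: "0 < a \<Longrightarrow> ennpowr top a = top"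
  and ennpowr_0_neg [simp]: "a < 0 \<Longrightarrow> ennpowr 0 a = top"
  by (auto simp: ennpowr_def)

lemma ennpowr_one [simp]: "ennpowr x 1 = x"
  by (cases x) (auto simp: ennpowr_def ennreal_eq_0_iff)

lemma ennpowr_eq_0_iff: "0 < a \<Longrightarrow> ennpowr x a = 0 \<longleftrightarrow> x = 0"
  by (cases x) (auto simp: ennpowr_def ennreal_eq_0_iff)

lemma ennpowr_eq_top_iff: "0 < a \<Longrightarrow> ennpowr x a = top \<longleftrightarrow> x = top"
  by (cases x) (auto simp: ennpowr_def)

lemma ennpowr_ennpowr:
  assumes "a \<noteq> 0" "b \<noteq> 0"
  shows "ennpowr (ennpowr x a) b = ennpowr x (a * b)"
  using assms
  by (cases x) (auto simp: ennpowr_def powr_powr ennreal_eq_0_iff zero_less_mult_iff)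

lemma ennpowr_mult:
  assumes "0 < a"
  shows "ennpowr (x * y) a = ennpowr x a * ennpowr y a"
proof (cases "x = 0 \<or> y = 0 \<or> x = top \<or> y = top")
  case True
  then show ?thesis using assms
    by (auto simp: ennreal_mult_top ennreal_top_mult ennpowr_eq_0_iff)
next
  case False
  then obtain r s where "x = ennreal r" "y = ennreal s" "0 < r" "0 < s"
    by (cases x; cases y) (auto simp: less_le)
  then show ?thesis by (simp add: ennpowr_ennreal powr_mult flip: ennreal_mult)
qed

lemma ennpowr_mono:
  assumes "0 < a" "x \<le> y" shows "ennpowr x a \<le> ennpowr y a"
proof (cases y)
  case (real s)
  then obtain r where "0 \<le> r" "x = ennreal r" using assms(2)
    by (cases x) (auto simp: top_unique)
  then show ?thesis using real assms
    by (auto simp: ennpowr_ennreal_nonneg intro!: ennreal_leI powr_mono2)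
qed (use assms in auto)

text \<open>For a positive exponent the power is an order automorphism of \<open>ennreal\<close>, whose inverse is the power
  with the reciprocal exponent; strict inequalities and suprema therefore pass through powers.\<close>

lemma ennpowr_less_iff:
  assumes "0 < a" shows "ennpowr x a < y \<longleftrightarrow> x < ennpowr y (1/a)"
    and "x < ennpowr y a \<longleftrightarrow> ennpowr x (1/a) < y"
proof -
  have *: "ennpowr (ennpowr x a) (1/a) = x" "ennpowr (ennpowr x (1/a)) a = x" for x
    using assms by (auto simp: ennpowr_ennpowr)
  have m: "0 < 1/a" using assms by simp
  show "ennpowr x a < y \<longleftrightarrow> x < ennpowr y (1/a)"
    using ennpowr_mono[OF assms] ennpowr_mono[OF m] * by (metis not_le)
  show "x < ennpowr y a \<longleftrightarrow> ennpowr x (1/a) < y"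
    using ennpowr_mono[OF assms] ennpowr_mono[OF m] * by (metis not_le)
qed

lemma ennpowr_add:
  assumes "x \<noteq> 0" "x \<noteq> top" shows "ennpowr x (a + b) = ennpowr x a * ennpowr x b"
  using assms by (cases x) (auto simp: ennpowr_ennreal powr_add ennreal_mult)

lemma ennpowr_inverse:
  assumes "0 < a" shows "ennpowr (inverse x) a = ennpowr x (- a)"
proof (cases "x = 0 \<or> x = top")
  case True then show ?thesis using assms by (auto simp: ennpowr_def)
next
  case False
  then obtain r where "x = ennreal r" "0 < r" by (cases x) (auto simp: less_le)
  then show ?thesis
    by (simp add: inverse_ennreal ennpowr_ennreal powr_minus powr_divide inverse_eq_divide)
qed

lemma ennpowr_pos_finite:
  assumes "x \<noteq> 0" "x \<noteq> top" shows "ennpowr x a \<noteq> 0" "ennpowr x a \<noteq> top"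
  using assms by (cases x; auto simp: ennpowr_def ennreal_eq_0_iff)+

lemma borel_measurable_ennpowr [measurable (raw)]:
  assumes [measurable]: "f \<in> borel_measurable M"
  shows "(\<lambda>x. ennpowr (f x) a) \<in> borel_measurable M"
  unfolding ennpowr_def by measurable

lemma ennreal_inverse_antimono: "x \<le> y \<Longrightarrow> inverse y \<le> inverse (x :: ennreal)"
  including ennreal.lifting by transfer (rule ereal_inverse_antimono)

lemma SUP_min_of_nat: "(SUP n. min (of_nat n) x) = (x::ennreal)"
proof (rule antisym)
  show "x \<le> (SUP n. min (of_nat n) x)"
  proof (cases "x = top")
    case True then show ?thesis by (simp add: ennreal_SUP_of_nat_eq_top)
  next
    case False
    then obtain n where "x < of_nat n" using ennreal_Ex_less_of_nat top.not_eq_extremum by blast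
    then show ?thesis by (intro SUP_upper2[of n]) auto
  qed
qed (auto intro: SUP_least)

text \<open>Lower semicontinuity of multiplication: an inequality for all levels below \<open>y\<close> extends to \<open>y\<close> itself,
  also for \<open>y = \<infinity>\<close>, which handles finite and infinite values together.\<close>

lemma le_mult_if_less:
  fixes y m C :: ennreal
  assumes "\<And>x. x < y \<Longrightarrow> x * m \<le> C" shows "y * m \<le> C"
proof -
  have "y = (SUP x\<in>{..<y}. x)" by simp
  then have "y * m = (SUP x\<in>{..<y}. x) * m" by simp
  also have "\<dots> = (SUP x\<in>{..<y}. x * m)" by (rule SUP_mult_right_ennreal)
  also have "\<dots> \<le> C" using assms by (intro SUP_least) auto
  finally show ?thesis .
qed

text \<open>Each \<open>x j\<close> is at most the sum \<open>S\<close>, so \<open>x j powr s\<close> is at most \<open>x j * S powr (s - 1)\<close>; add up. This is where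
  \<open>p \<le> q\<close> enters the weak type bound, with \<open>s = q / p\<close>.\<close>

lemma sum_ennpowr_le:
  assumes "finite F" "1 \<le> s"
  shows "(\<Sum>j\<in>F. ennpowr (x j) s) \<le> ennpowr (\<Sum>j\<in>F. x j) s"
proof (cases "s = 1 \<or> (\<Sum>j\<in>F. x j) = 0 \<or> (\<Sum>j\<in>F. x j) = top")
  case True
  then consider "s = 1" | "(\<Sum>j\<in>F. x j) = 0" | "(\<Sum>j\<in>F. x j) = top" by blast
  then show ?thesis
  proof cases
    case 2
    then have "\<forall>j\<in>F. x j = 0" using assms(1) by simp
    then show ?thesis using assms by simp
  next
    case 3
    have "ennpowr (\<Sum>j\<in>F. x j) s = top" unfolding 3 using assms(2) by simp
    then show ?thesis by (metis top_greatest)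
  qed simp
next
  case False
  let ?S = "\<Sum>j\<in>F. x j"
  from False have s: "0 < s - 1" and S: "?S \<noteq> 0" "?S \<noteq> top" using assms by auto
  have "ennpowr (x j) s \<le> x j * ennpowr ?S (s - 1)" if "j \<in> F" for j
  proof (cases "x j = 0")
    case True then show ?thesis using assms by simp
  next
    case False
    have le: "x j \<le> ?S" using assms that by (intro member_le_sum) auto
    then have "x j \<noteq> top" using S by (auto simp: top_unique)
    then have "ennpowr (x j) s = x j * ennpowr (x j) (s - 1)"
      using False ennpowr_add[of "x j" 1 "s - 1"] by simp
    also have "\<dots> \<le> x j * ennpowr ?S (s - 1)"
      by (intro mult_left_mono ennpowr_mono le s) auto
    finally show ?thesis .
  qed
  then have "(\<Sum>j\<in>F. ennpowr (x j) s) \<le> (\<Sum>j\<in>F. x j * ennpowr ?S (s - 1))"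
    by (intro sum_mono)
  also have "\<dots> = ?S * ennpowr ?S (s - 1)" by (simp add: sum_distrib_right)
  also have "\<dots> = ennpowr ?S s" using S ennpowr_add[of ?S 1 "s - 1"] by simp
  finally show ?thesis .
qed

lemma Young_ennreal:
  fixes a b :: ennreal
  assumes "1 < p" "1 < p'" "1/p + 1/p' = 1"
  shows "a * b \<le> ennpowr a p * ennreal (1/p) + ennpowr b p' * ennreal (1/p')"
proof (cases "a = top \<or> b = top")
  case True
  then show ?thesis using assms
    by (auto simp: ennreal_eq_0_iff ennreal_top_mult)
next
  case False
  then obtain r s where rs: "a = ennreal r" "b = ennreal s" "0 \<le> r" "0 \<le> s"
    by (metis ennreal_cases infinity_ennreal_def)
  have "r * s \<le> r powr p / p + s powr p' / p'"
    using Youngs_inequality[of p p' r s] assms rs by simp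
  then show ?thesis using assms rs
    by (simp add: ennpowr_ennreal_nonneg flip: ennreal_mult ennreal_plus)
qed

text \<open>After division by the two norms, integrate Young's inequality. Zero or infinite norms are
  treated apart, because they cannot be divided by.\<close>

lemma Hoelder_nn_integral:
  assumes [measurable]: "u \<in> borel_measurable M" "v \<in> borel_measurable M"
    and p: "1 < p" "1 < p'" "1/p + 1/p' = 1"
  shows "(\<integral>\<^sup>+x. u x * v x \<partial>M) \<le>
    ennpowr (\<integral>\<^sup>+x. ennpowr (u x) p \<partial>M) (1/p) * ennpowr (\<integral>\<^sup>+x. ennpowr (v x) p' \<partial>M) (1/p')"
proof -
  define U V where "U = (\<integral>\<^sup>+x. ennpowr (u x) p \<partial>M)" and "V = (\<integral>\<^sup>+x. ennpowr (v x) p' \<partial>M)"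
  have pos: "0 < p" "0 < p'" "0 < 1/p" "0 < 1/p'" using p by auto
  show ?thesis
  proof (cases "U = 0 \<or> V = 0")
    case True
    then have "(AE x in M. u x = 0) \<or> (AE x in M. v x = 0)"
      using pos by (auto simp: U_def V_def nn_integral_0_iff_AE ennpowr_eq_0_iff)
    then have "AE x in M. u x * v x = 0" by (auto elim: AE_mp)
    then have "(\<integral>\<^sup>+x. u x * v x \<partial>M) = 0" by (subst nn_integral_0_iff_AE) auto
    then show ?thesis by simp
  next
    case nz: False
    show ?thesis
    proof (cases "U = top \<or> V = top")
      case True
      then have "ennpowr U (1/p) * ennpowr V (1/p') = top"
        using nz pos by (auto simp: ennreal_mult_eq_top_iff ennpowr_eq_top_iff ennpowr_eq_0_iff)
      then show ?thesis by (simp add: U_def V_def)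
    next
      case False
      let ?a = "ennpowr U (1/p)" and ?b = "ennpowr V (1/p')"
      have ab: "?a \<noteq> 0" "?a \<noteq> top" "?b \<noteq> 0" "?b \<noteq> top" using nz False ennpowr_pos_finite by blast+
      have n: "ennpowr (y / ennpowr X (1/r)) r = ennpowr y r / X"
        if "X \<noteq> 0" "X \<noteq> top" "0 < r" for X y r
      proof -
        have "ennpowr (inverse (ennpowr X (1/r))) r = inverse X"
        proof (cases X)
          case (real c)
          then have "0 < c" using that by (auto simp: ennreal_eq_0_iff)
          then have "inverse (ennpowr X (1/r)) = ennreal (inverse (c powr (1/r)))"
            using real by (simp add: ennpowr_ennreal inverse_ennreal)
          moreover have "inverse (c powr (1/r)) powr r = inverse c"
            using \<open>0 < c\<close> that(3) by (simp add: powr_divide powr_powr inverse_eq_divide)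
          ultimately show ?thesis using \<open>0 < c\<close> real
            by (simp add: ennpowr_ennreal inverse_ennreal)
        qed (use that in simp)
        then show ?thesis using that by (simp add: divide_ennreal_def ennpowr_mult)
      qed
      have "(\<integral>\<^sup>+x. u x * v x \<partial>M) / (?a * ?b) = (\<integral>\<^sup>+x. (u x / ?a) * (v x / ?b) \<partial>M)"
      proof -
        have i: "inverse (?a * ?b) = inverse ?a * inverse ?b"
          by (intro ennreal_inverse_mult) (use ab in \<open>auto simp: top.not_eq_extremum\<close>)
        have "(\<integral>\<^sup>+x. (u x / ?a) * (v x / ?b) \<partial>M) = (\<integral>\<^sup>+x. (u x * v x) * inverse (?a * ?b) \<partial>M)"
          by (simp add: i divide_ennreal_def mult_ac)
        then show ?thesis by (simp add: nn_integral_multc divide_ennreal_def)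
      qed
      also have "\<dots> \<le> (\<integral>\<^sup>+x. ennpowr (u x) p / U * ennreal (1/p) + ennpowr (v x) p' / V * ennreal (1/p') \<partial>M)"
        using Young_ennreal[OF p] n nz False pos
        by (intro nn_integral_mono) metis
      also have "\<dots> = U / U * ennreal (1/p) + V / V * ennreal (1/p')"
        by (simp add: nn_integral_add nn_integral_multc nn_integral_divide U_def V_def)
      also have "\<dots> = 1"
        using nz False pos p by (simp add: top.not_eq_extremum flip: ennreal_plus)
      finally have "(\<integral>\<^sup>+x. u x * v x \<partial>M) / (?a * ?b) \<le> 1" .
      moreover have "?a * ?b \<noteq> 0" "?a * ?b \<noteq> top"
        using ab by (auto simp: ennreal_mult_eq_top_iff)
      ultimately have "(\<integral>\<^sup>+x. u x * v x \<partial>M) \<le> ?a * ?b"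
        using mult_right_mono[of "(\<integral>\<^sup>+x. u x * v x \<partial>M) / (?a * ?b)" 1 "?a * ?b"]
        by (simp add: ennreal_divide_times top.not_eq_extremum)
      then show ?thesis by (simp add: U_def V_def)
    qed
  qed
qed

section \<open>Carleson boxes and the maximal function\<close>

lemma bdd_intervalE:
  assumes "bdd_interval I"
  obtains a b where "a < b" "{a<..<b} \<subseteq> I" "I \<subseteq> {a..b}" "measure lebesgue I = b - a"
proof -
  define a b where "a = Inf I" and "b = Sup I"
  have I: "is_interval I" "bounded I" "I \<noteq> {}" and pos: "0 < measure lebesgue I"
    using assms by (auto simp: bdd_interval_def)
  have bdd: "bdd_below I" "bdd_above I"
    using I(2) by (auto intro: bounded_imp_bdd_below bounded_imp_bdd_above)
  have sub: "I \<subseteq> {a..b}"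
    using bdd by (auto simp: a_def b_def intro: cInf_lower cSup_upper)
  have sup: "{a<..<b} \<subseteq> I"
  proof
    fix x assume "x \<in> {a<..<b}"
    then obtain y z where "y \<in> I" "y < x" "z \<in> I" "x < z"
      using cInf_less_iff[OF I(3) bdd(1), of x] less_cSup_iff[OF I(3) bdd(2), of x]
      by (auto simp: a_def b_def)
    then show "x \<in> I" using I(1) by (meson is_interval_1 less_imp_le)
  qed
  have le: "a \<le> b" using I(3) sub by fastforce
  have Im: "I \<in> sets lebesgue"
    using real_interval_borel_measurable[OF I(1)] by (simp add: sets_completionI_sets)
  have fin: "{a..b} \<in> lmeasurable" "I \<in> lmeasurable"
    using fmeasurableI2[OF _ sub Im] by auto
  have "measure lebesgue {a<..<b} \<le> measure lebesgue I"
    by (intro measure_mono_fmeasurable sup fin) auto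
  moreover have "measure lebesgue I \<le> measure lebesgue {a..b}"
    by (intro measure_mono_fmeasurable sub fin Im)
  ultimately have m: "measure lebesgue I = b - a" using le by simp
  then have "a < b" using pos by simp
  then show thesis using that sup sub m by blast
qed

lemma bdd_interval_greaterThanLessThan: "a < b \<Longrightarrow> bdd_interval {a<..<b}"
  by (simp add: bdd_interval_def is_interval_oo bounded_subset[of "{a..b}"])

lemma carleson_box_subset_upper_half_plane: "carleson_box I \<subseteq> upper_half_plane"
  by (auto simp: carleson_box_def upper_half_plane_def)

lemma open_upper_half_plane: "open upper_half_plane"
  unfolding upper_half_plane_def by (rule open_halfspace_Im_gt)

lemma upper_half_plane_sets [measurable]: "upper_half_plane \<in> sets lebesgue"
  using open_upper_half_plane by (simp add: borel_open)

lemma borel_carleson_box: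
  assumes "bdd_interval I" shows "carleson_box I \<in> sets borel"
proof -
  have [measurable]: "I \<in> sets borel"
    using assms by (auto simp: bdd_interval_def intro: real_interval_borel_measurable)
  have "{z \<in> space borel. Re z \<in> I \<and> 0 < Im z \<and> Im z < measure lebesgue I} \<in> sets borel"
    by measurable
  then show ?thesis by (simp add: carleson_box_def)
qed

lemma lebesgue_carleson_box: "bdd_interval I \<Longrightarrow> carleson_box I \<in> sets lebesgue"
  using borel_carleson_box by (simp add: sets_completionI_sets)

text \<open>Whichever endpoints belong to the interval, the box lies between an open and a closed square of the
  same area.\<close>

lemma emeasure_carleson_box:
  assumes "bdd_interval I"
  shows "emeasure lebesgue (carleson_box I) = ennreal ((measure lebesgue I)\<^sup>2)"
proof -
  obtain a b where ab: "a < b" "{a<..<b} \<subseteq> I" "I \<subseteq> {a..b}" "measure lebesgue I = b - a"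
    using assms by (rule bdd_intervalE)
  let ?l = "Complex a 0" and ?u = "Complex b (b - a)"
  have sub: "box ?l ?u \<subseteq> carleson_box I" "carleson_box I \<subseteq> cbox ?l ?u"
    using ab by (auto simp: carleson_box_def in_box_complex_iff in_cbox_complex_iff)
  have [simp]: "(1::complex) \<noteq> \<i>" by (simp add: complex_eq_iff)
  have "emeasure lebesgue (box ?l ?u) = ennreal ((b - a)\<^sup>2)"
    "emeasure lebesgue (cbox ?l ?u) = ennreal ((b - a)\<^sup>2)"
    using ab(1) by (auto simp: emeasure_lborel_box_eq emeasure_lborel_cbox_eq Basis_complex_def power2_eq_square)
  with emeasure_mono[OF sub(1), of lebesgue] emeasure_mono[OF sub(2), of lebesgue]
    lebesgue_carleson_box[OF assms] ab(4)
  show ?thesis by (auto intro!: antisym)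
qed

lemma emeasure_carleson_box_pos_finite:
  assumes "bdd_interval I"
  shows "emeasure lebesgue (carleson_box I) \<noteq> 0" "emeasure lebesgue (carleson_box I) \<noteq> top"
  using assms by (auto simp: emeasure_carleson_box bdd_interval_def ennreal_eq_0_iff)

lemma carleson_box_mono:
  assumes "bdd_interval I" "bdd_interval J" "I \<subseteq> J"
  shows "carleson_box I \<subseteq> carleson_box J"
proof -
  have *: "measure lebesgue I \<le> measure lebesgue J"
    using assms bdd_interval_def
    by (intro measure_mono_fmeasurable)
      (auto intro!: bounded_set_imp_lmeasurable real_interval_borel_measurable sets_completionI_sets)
  show ?thesis using assms(3) * by (auto simp: carleson_box_def)
qed

lemma open_carleson_box: "open I \<Longrightarrow> open (carleson_box I)"
  unfolding carleson_box_def
  by (intro open_Collect_conj open_Collect_less continuous_intros)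
    (auto intro!: continuous_open_vimage[unfolded vimage_def] continuous_intros)

lemma disjoint_carleson_box: "disjnt I J \<Longrightarrow> disjnt (carleson_box I) (carleson_box J)"
  by (auto simp: carleson_box_def disjnt_def)

text \<open>Enlarging the interval slightly does not decrease the integral and changes the area
  continuously, so a strict lower bound for the average survives.\<close>

lemma exists_open_interval_box_average_gt:
  assumes I: "bdd_interval I" and gt: "ennreal l < box_average I g" and l: "0 < l"
  shows "\<exists>a b. a < b \<and> I \<subseteq> {a<..<b} \<and> ennreal l < box_average {a<..<b} g"
proof -
  obtain a b where ab: "a < b" "{a<..<b} \<subseteq> I" "I \<subseteq> {a..b}" "measure lebesgue I = b - a"
    using I by (rule bdd_intervalE)
  define X where "X = (\<integral>\<^sup>+z\<in>carleson_box I. g z \<partial>lebesgue)"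
  have "ennreal (l * (b - a)\<^sup>2) < X"
    using gt ab(1) l ennreal_mult_strict_right_mono[OF gt, of "ennreal ((b - a)\<^sup>2)"]
    by (simp add: box_average_def emeasure_carleson_box[OF I] ab(4) X_def
        ennreal_divide_times ennreal_mult)
  \<comment> \<open>A real level between \<open>l\<close> times the area and the integral, which may be infinite.\<close>
  then obtain y where y: "ennreal y < X" "l * (b - a)\<^sup>2 < y"
  proof -
    assume *: "\<And>y. ennreal y < X \<Longrightarrow> l * (b - a)\<^sup>2 < y \<Longrightarrow> thesis"
    obtain w where "ennreal (l * (b - a)\<^sup>2) < w" "w < X"
      using dense \<open>ennreal (l * (b - a)\<^sup>2) < X\<close> by blast
    then show thesis using * l by (cases w) (auto simp: ennreal_less_iff)
  qed
  have "((\<lambda>e. l * (b - a + 2 * e)\<^sup>2) \<longlongrightarrow> l * (b - a + 2 * 0)\<^sup>2) (at_right 0)"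
    by (intro tendsto_intros)
  then have "eventually (\<lambda>e. l * (b - a + 2 * e)\<^sup>2 < y) (at_right 0)"
    using y(2) by (intro order_tendstoD) auto
  then have "eventually (\<lambda>e. 0 < e \<and> l * (b - a + 2 * e)\<^sup>2 < y) (at_right 0)"
    using eventually_at_right_less[of "0::real"] by eventually_elim simp
  then obtain e where e: "0 < e" "l * (b - a + 2 * e)\<^sup>2 < y"
    using eventually_happens[of _ "at_right (0::real)"] by auto
  let ?J = "{a - e<..<b + e}"
  have J: "bdd_interval ?J" and IJ: "I \<subseteq> ?J" and mJ: "measure lebesgue ?J = b - a + 2 * e"
    using ab e(1) by (auto simp: bdd_interval_greaterThanLessThan)
  let ?Y = "\<integral>\<^sup>+z\<in>carleson_box ?J. g z \<partial>lebesgue"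
  have "X \<le> ?Y"
    using carleson_box_mono[OF I J IJ] unfolding X_def
    by (intro nn_integral_mono) (auto simp: indicator_def)
  moreover have "ennreal (l * (b - a + 2 * e)\<^sup>2) < X"
    using y(1) e(2) by (meson ennreal_leI less_imp_le order_le_less_trans)
  ultimately have *: "ennreal l * ennreal ((b - a + 2 * e)\<^sup>2) < ?Y"
    using l by (simp flip: ennreal_mult)
  have "ennreal l < ?Y / ennreal ((b - a + 2 * e)\<^sup>2)"
  proof (rule ccontr)
    assume "\<not> ennreal l < ?Y / ennreal ((b - a + 2 * e)\<^sup>2)"
    then have "?Y / ennreal ((b - a + 2 * e)\<^sup>2) * ennreal ((b - a + 2 * e)\<^sup>2) \<le>
        ennreal l * ennreal ((b - a + 2 * e)\<^sup>2)"
      by (intro mult_right_mono) auto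
    moreover have "ennreal ((b - a + 2 * e)\<^sup>2) \<noteq> 0" using ab(1) e(1) by (simp add: ennreal_eq_0_iff)
    ultimately show False using * by (simp add: ennreal_divide_times)
  qed
  then have "ennreal l < box_average ?J g"
    by (simp only: box_average_def emeasure_carleson_box[OF J] mJ)
  with IJ ab(1) e(1) show ?thesis by (intro exI[of _ "a - e"] exI[of _ "b + e"]) auto
qed

lemma bdd_interval_ball: "0 < r \<Longrightarrow> bdd_interval (ball (x::real) r)"
  by (simp add: ball_eq_greaterThanLessThan bdd_interval_greaterThanLessThan)

lemma measure_ball_real: "0 < r \<Longrightarrow> measure lebesgue (ball (x::real) r) = 2 * r"
  by (simp add: ball_eq_greaterThanLessThan)

text \<open>Only open intervals matter for the superlevel sets, which are therefore open and in particular
  measurable. Writing the intervals as balls prepares for the Vitali covering lemma.\<close>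

lemma maximal_fun_superlevel_set:
  assumes "0 < l"
  shows "{z\<in>upper_half_plane. ennreal l < maximal_fun f z} =
    (\<Union>(x, r)\<in>{(x, r). 0 < r \<and> ennreal l < box_average (ball x r) (\<lambda>w. ennreal (norm (f w)))}.
      carleson_box (ball x r))" (is "?L = ?R")
proof (intro antisym subsetI)
  fix z assume "z \<in> ?L"
  then obtain I where I: "bdd_interval I" "z \<in> carleson_box I"
      "ennreal l < box_average I (\<lambda>w. ennreal (norm (f w)))"
    by (auto simp: maximal_fun_def less_SUP_iff)
  then obtain a b where ab: "a < b" "I \<subseteq> {a<..<b}"
      "ennreal l < box_average {a<..<b} (\<lambda>w. ennreal (norm (f w)))"
    using exists_open_interval_box_average_gt assms by blast
  have "z \<in> carleson_box {a<..<b}"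
    using carleson_box_mono[OF I(1) bdd_interval_greaterThanLessThan[OF ab(1)] ab(2)] I(2) by blast
  then show "z \<in> ?R"
    using ab unfolding greaterThanLessThan_eq_ball
    by (intro UN_I[of "((a + b) / 2, (b - a) / 2)"]) auto
next
  fix z assume "z \<in> ?R"
  then obtain x r where "0 < r" "ennreal l < box_average (ball x r) (\<lambda>w. ennreal (norm (f w)))"
      "z \<in> carleson_box (ball x r)" by auto
  then show "z \<in> ?L"
    using carleson_box_subset_upper_half_plane bdd_interval_ball
    by (auto simp: maximal_fun_def less_SUP_iff intro!: exI[of _ "ball x r"])
qed

lemma open_maximal_fun_superlevel_set:
  "0 < l \<Longrightarrow> open {z\<in>upper_half_plane. ennreal l < maximal_fun f z}"
  unfolding maximal_fun_superlevel_set by (intro open_UN) (auto intro: open_carleson_box)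

section \<open>Averages over a box and the dual mean\<close>

abbreviation weighted_integral :: "real \<Rightarrow> (complex \<Rightarrow> real) \<Rightarrow> complex set \<Rightarrow> (complex \<Rightarrow> complex) \<Rightarrow> ennreal"
  where "weighted_integral p \<omega> S f \<equiv> \<integral>\<^sup>+z\<in>S. ennreal (norm (f z) powr p * \<omega> z) \<partial>lebesgue"

abbreviation box_mean :: "real set \<Rightarrow> (complex \<Rightarrow> complex) \<Rightarrow> ennreal"
  where "box_mean I f \<equiv> box_average I (\<lambda>z. ennreal (norm (f z)))"

text \<open>Exhaust the half-plane by countably many compact sets.\<close>

lemma locally_integrable_imp_borel_measurable:
  assumes "locally_integrable f"
  shows "f \<in> borel_measurable (lebesgue_on upper_half_plane)"
proof -
  obtain C :: "nat \<Rightarrow> complex set" where C: "\<And>n. compact (C n)" "\<And>n. C n \<subseteq> upper_half_plane"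
      "\<Union>(range C) = upper_half_plane"
    using open_Union_compact_subsets[OF open_upper_half_plane] by metis
  show ?thesis
  proof (rule measurable_piecewise_restrict[of "range C"])
    fix X assume "X \<in> range C"
    then have X: "compact X" "X \<subseteq> upper_half_plane" using C by auto
    then have Xs: "X \<in> sets lebesgue" by (simp add: borel_compact)
    then show "X \<inter> space (lebesgue_on upper_half_plane) \<in> sets (lebesgue_on upper_half_plane)"
      using X by (auto simp: sets_restrict_space)
    have "f \<in> borel_measurable (lebesgue_on X)"
      using assms X absolutely_integrable_measurable[OF Xs] by (auto simp: locally_integrable_def)
    then show "f \<in> borel_measurable (restrict_space (lebesgue_on upper_half_plane) X)"
      using X by (simp add: restrict_restrict_space Xs Int_absorb1)
  qed (use C in auto)
qed

lemma set_nn_integral_carleson_box: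
  "bdd_interval I \<Longrightarrow> (\<integral>\<^sup>+z\<in>carleson_box I. g z \<partial>lebesgue) = (\<integral>\<^sup>+z. g z \<partial>lebesgue_on (carleson_box I))"
  by (subst nn_integral_restrict_space) (auto simp: lebesgue_carleson_box)

lemma measurable_on_carleson_box:
  "f \<in> borel_measurable (lebesgue_on upper_half_plane) \<Longrightarrow> f \<in> borel_measurable (lebesgue_on (carleson_box I))"
  by (rule measurable_restrict_mono[OF _ carleson_box_subset_upper_half_plane])

lemma weight_measurable: "weight \<omega> \<Longrightarrow> \<omega> \<in> borel_measurable (lebesgue_on upper_half_plane)"
  by (simp add: weight_def locally_integrable_imp_borel_measurable)

lemma weight_nonneg: "weight \<omega> \<Longrightarrow> z \<in> carleson_box I \<Longrightarrow> 0 \<le> \<omega> z"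
  using carleson_box_subset_upper_half_plane by (auto simp: weight_def)

text \<open>The supremum in the definition is attained: it is the supremum of countably many lower bounds,
  each of which holds almost everywhere.\<close>

lemma AE_ess_inf_le: "AE z in M. ess_inf M g \<le> g z"
proof -
  let ?A = "{c. AE z in M. c \<le> g z}"
  have "?A \<noteq> {}" by (auto intro!: exI[of _ 0])
  then obtain c :: "nat \<Rightarrow> ennreal" where c: "range c \<subseteq> ?A" "Sup ?A = (SUP i. c i)"
    using ennreal_Sup_countable_SUP by metis
  then have "AE z in M. \<forall>i. c i \<le> g z" by (subst AE_all_countable) auto
  then show ?thesis
    unfolding ess_inf_def c(2) by eventually_elim (auto intro: SUP_least)
qed

lemma conj_exponent_props:
  assumes "1 < p"
  shows "1 < conj_exponent p" "1 / p + 1 / conj_exponent p = 1"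
    "- (1 / p) * conj_exponent p = 1 - conj_exponent p"
    "(1 - conj_exponent p) * (p - 1) = - 1"
  using assms by (auto simp: conj_exponent_def field_simps)

lemma not_AE_False_carleson_box:
  assumes "bdd_interval I" shows "\<not> (AE z in lebesgue_on (carleson_box I). False)"
  using emeasure_carleson_box_pos_finite(1)[OF assms] lebesgue_carleson_box[OF assms]
  by (simp add: AE_restrict_space_iff AE_iff_null_sets[symmetric] null_sets_def)

text \<open>A weight has real values and a box has positive area.\<close>

lemma ess_inf_weight_less_top:
  assumes "bdd_interval I"
  shows "ess_inf (lebesgue_on (carleson_box I)) (\<lambda>z. ennreal (\<omega> z)) < top"
proof (rule ccontr)
  assume "\<not> ?thesis"
  then have "AE z in lebesgue_on (carleson_box I). top \<le> ennreal (\<omega> z)"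
    using AE_ess_inf_le[of "lebesgue_on (carleson_box I)" "\<lambda>z. ennreal (\<omega> z)"]
    by (simp add: top.not_eq_extremum[symmetric])
  then have "AE z in lebesgue_on (carleson_box I). False" by eventually_elim (simp add: top_unique)
  then show False using not_AE_False_carleson_box[OF assms] by simp
qed

text \<open>A finite dual mean means that the weight is positive almost everywhere on the box, so that
  \<open>norm f\<close> is the product of the two Hoelder factors. For \<open>p = 1\<close> the essential infimum of the weight can
  be pulled out of the integral.\<close>

lemma box_mean_le_dual_mean:
  assumes p: "1 \<le> p" and \<omega>: "weight \<omega>" and I: "bdd_interval I"
    and f: "f \<in> borel_measurable (lebesgue_on upper_half_plane)"
    and fin: "dual_mean p \<omega> I \<noteq> top"
  shows "box_mean I f \<le> ennpowr (emeasure lebesgue (carleson_box I)) (- (1 / p)) *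
    dual_mean p \<omega> I * ennpowr (weighted_integral p \<omega> (carleson_box I) f) (1 / p)"
proof -
  define M where "M = lebesgue_on (carleson_box I)"
  define V where "V = emeasure lebesgue (carleson_box I)"
  define N W where "N = (\<integral>\<^sup>+z. ennreal (norm (f z)) \<partial>M)"
    and "W = (\<integral>\<^sup>+z. ennreal (norm (f z) powr p * \<omega> z) \<partial>M)"
  have [measurable]: "f \<in> borel_measurable M" "\<omega> \<in> borel_measurable M"
    using f weight_measurable[OF \<omega>] by (auto simp: M_def intro: measurable_on_carleson_box)
  have V: "V \<noteq> 0" "V \<noteq> top" using emeasure_carleson_box_pos_finite[OF I] by (auto simp: V_def)
  have sp: "space M = carleson_box I" by (simp add: M_def space_restrict_space)
  have bm: "box_mean I f = N / V"
    by (simp add: box_average_def set_nn_integral_carleson_box[OF I] N_def M_def V_def)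
  have W: "weighted_integral p \<omega> (carleson_box I) f = W"
    by (simp add: set_nn_integral_carleson_box[OF I] W_def M_def)
  have "N / V \<le> ennpowr V (- (1 / p)) * dual_mean p \<omega> I * ennpowr W (1 / p)"
  proof (cases "p = 1")
    case True
    define m where "m = ess_inf M (\<lambda>z. ennreal (\<omega> z))"
    have dm: "dual_mean p \<omega> I = inverse m" by (simp add: dual_mean_def True m_def M_def)
    have m: "m \<noteq> 0" "m \<noteq> top"
      using fin ess_inf_weight_less_top[OF I, of \<omega>] by (auto simp: dm m_def M_def)
    have "m * N = (\<integral>\<^sup>+z. m * ennreal (norm (f z)) \<partial>M)"
      by (simp add: N_def nn_integral_cmult)
    also have "\<dots> \<le> W" unfolding W_def
    proof (rule nn_integral_mono_AE)
      show "AE z in M. m * ennreal (norm (f z)) \<le> ennreal (norm (f z) powr p * \<omega> z)"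
        using AE_ess_inf_le[of M "\<lambda>z. ennreal (\<omega> z)"]
        by eventually_elim
          (auto simp: True ennreal_mult' m_def mult.commute[of _ "ennreal (norm _)"] intro!: mult_left_mono)
    qed
    finally have "inverse m * (m * N) \<le> inverse m * W" by (rule mult_left_mono) simp
    moreover have "inverse m * m = 1"
      using m by (metis ennreal_divide_self divide_ennreal_def mult.commute top.not_eq_extremum)
    ultimately have "N \<le> inverse m * W" by (simp flip: mult.assoc)
    then have "N * inverse V \<le> inverse m * W * inverse V" by (rule mult_right_mono) simp
    moreover have "ennpowr V (- 1) = inverse V" using ennpowr_inverse[of 1 V] by simp
    ultimately show ?thesis by (simp add: True dm[unfolded True] divide_ennreal_def mult_ac)
  next
    case False
    then have p1: "1 < p" using p by simp
    define p' where "p' = conj_exponent p"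
    note p' = conj_exponent_props[OF p1, folded p'_def]
    define A where "A = (\<integral>\<^sup>+z. ennpowr (ennreal (\<omega> z)) (1 - p') \<partial>M)"
    have dm: "dual_mean p \<omega> I = ennpowr (A / V) (1 / p')"
      using False by (simp add: dual_mean_def box_average_def A_def M_def V_def
          set_nn_integral_carleson_box[OF I] p'_def)
    then have "A / V \<noteq> top" using fin p'(1) by (simp add: ennpowr_eq_top_iff)
    then have "A \<noteq> top" using V by (auto simp: ennreal_divide_eq_top_iff)
    then have "AE z in M. ennpowr (ennreal (\<omega> z)) (1 - p') \<noteq> \<infinity>"
      unfolding A_def by (intro nn_integral_PInf_AE) auto
    moreover have "0 < x" if "ennpowr (ennreal x) (1 - p') \<noteq> \<infinity>" for x
      using that p'(1) by (cases "0 < x") (auto simp: not_less ennreal_neg)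
    ultimately have AE: "AE z in M. 0 < \<omega> z" by (auto elim: AE_mp)
    let ?u = "\<lambda>z. ennreal (norm (f z)) * ennpowr (ennreal (\<omega> z)) (1 / p)"
    let ?v = "\<lambda>z. ennpowr (ennreal (\<omega> z)) (- (1 / p))"
    have "N = (\<integral>\<^sup>+z. ?u z * ?v z \<partial>M)" unfolding N_def
    proof (rule nn_integral_cong_AE)
      show "AE z in M. ennreal (norm (f z)) = ?u z * ?v z"
        using AE by eventually_elim
          (simp add: ennpowr_ennreal powr_minus field_simps flip: ennreal_mult)
    qed
    also have "\<dots> \<le> ennpowr (\<integral>\<^sup>+z. ennpowr (?u z) p \<partial>M) (1 / p) *
        ennpowr (\<integral>\<^sup>+z. ennpowr (?v z) p' \<partial>M) (1 / p')"
      by (rule Hoelder_nn_integral) (use p1 p' in auto)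
    also have "(\<integral>\<^sup>+z. ennpowr (?u z) p \<partial>M) = W" unfolding W_def
    proof (rule nn_integral_cong)
      fix z assume "z \<in> space M"
      then have "0 \<le> \<omega> z" using weight_nonneg[OF \<omega>] sp by auto
      then show "ennpowr (?u z) p = ennreal (norm (f z) powr p * \<omega> z)"
        using p1 by (simp add: ennpowr_mult ennpowr_ennpowr ennpowr_ennreal_nonneg ennreal_mult powr_powr)
    qed
    also have "(\<integral>\<^sup>+z. ennpowr (?v z) p' \<partial>M) = A" unfolding A_def
      using p1 p' by (intro nn_integral_cong) (simp add: ennpowr_ennpowr)
    finally have "N * inverse V \<le> ennpowr W (1 / p) * ennpowr A (1 / p') * inverse V"
      by (rule mult_right_mono) simp
    moreover have "inverse V = ennpowr V (- (1 / p)) * ennpowr (inverse V) (1 / p')"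
    proof -
      have "inverse V = ennpowr V (- 1)" using ennpowr_inverse[of 1 V] by simp
      also have "- 1 = - (1 / p) + - (1 / p')" using p'(2) by simp
      also have "ennpowr V (- (1 / p) + - (1 / p')) =
          ennpowr V (- (1 / p)) * ennpowr (inverse V) (1 / p')"
        unfolding ennpowr_add[OF V] using p'(1) by (subst ennpowr_inverse) auto
      finally show ?thesis .
    qed
    moreover have "ennpowr W (1 / p) * ennpowr A (1 / p') *
        (ennpowr V (- (1 / p)) * ennpowr (inverse V) (1 / p')) =
        ennpowr V (- (1 / p)) * dual_mean p \<omega> I * ennpowr W (1 / p)"
      using p' by (simp add: dm divide_ennreal_def ennpowr_mult mult_ac)
    ultimately show ?thesis by (metis divide_ennreal_def)
  qed
  then show ?thesis by (simp add: bm W V_def)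
qed

text \<open>The competitors for which both the weak type bound and the bound on averages can be applied: boundedness
  makes them locally integrable, and the finite integral makes them members of the weighted space.\<close>

definition box_test_function :: "real \<Rightarrow> (complex \<Rightarrow> real) \<Rightarrow> real set \<Rightarrow> (complex \<Rightarrow> complex) \<Rightarrow> bool"
  where "box_test_function p \<omega> I f \<longleftrightarrow> f \<in> borel_measurable (lebesgue_on upper_half_plane) \<and>
    (\<exists>B. \<forall>z. norm (f z) \<le> B) \<and> (\<forall>z. z \<notin> carleson_box I \<longrightarrow> f z = 0) \<and>
    weighted_integral p \<omega> (carleson_box I) f < top"

text \<open>Sharpness of the bound \<open>box_mean_le_dual_mean\<close>, with any constant below the dual mean. For \<open>p = 1\<close> an indicator of a
  set on which \<open>\<omega> < m'\<close> satisfies \<open>W \<le> m' * A\<close>, where \<open>A\<close> is the integral of the test function. For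
  \<open>p > 1\<close>, equality in Hoelder's inequality holds for \<open>\<omega> powr (1 - p')\<close>, where \<open>W = A\<close>; its truncations \<open>h n\<close> are
  bounded and still satisfy \<open>W \<le> A\<close>, and their integrals converge to that of the full function.\<close>

lemma exists_box_test_function:
  assumes p: "1 \<le> p" and \<omega>: "weight \<omega>" and I: "bdd_interval I" and c: "c < dual_mean p \<omega> I"
  shows "\<exists>f. box_test_function p \<omega> I f \<and> box_mean I f \<noteq> 0 \<and>
    c * ennpowr (emeasure lebesgue (carleson_box I)) (- (1 / p)) *
      ennpowr (weighted_integral p \<omega> (carleson_box I) f) (1 / p) \<le> box_mean I f"
proof -
  define Q where "Q = carleson_box I"
  define M where "M = lebesgue_on Q"
  define V where "V = emeasure lebesgue Q"
  have V: "V \<noteq> 0" "V \<noteq> top" using emeasure_carleson_box_pos_finite[OF I] by (auto simp: V_def Q_def)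
  have Qs: "Q \<in> sets lebesgue" using lebesgue_carleson_box[OF I] by (simp add: Q_def)
  have QU: "Q \<subseteq> upper_half_plane" unfolding Q_def by (rule carleson_box_subset_upper_half_plane)
  have [measurable]: "Q \<in> sets (lebesgue_on upper_half_plane)" "upper_half_plane \<in> sets lebesgue"
    using Qs QU by (auto simp: sets_restrict_space image_iff intro!: bexI[of _ Q])
  have [measurable]: "\<omega> \<in> borel_measurable (lebesgue_on upper_half_plane)" "\<omega> \<in> borel_measurable M"
    using weight_measurable[OF \<omega>] by (auto simp: M_def Q_def intro: measurable_on_carleson_box)
  have sp: "space M = Q" by (simp add: M_def space_restrict_space)
  have eM: "emeasure M E = emeasure lebesgue E" if "E \<subseteq> Q" for E
    using that Qs by (simp add: M_def emeasure_restrict_space)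
  have wpos: "0 \<le> \<omega> z" if "z \<in> Q" for z using that weight_nonneg[OF \<omega>] by (simp add: Q_def)
  have int: "(\<integral>\<^sup>+z\<in>Q. g z \<partial>lebesgue) = (\<integral>\<^sup>+z. g z \<partial>M)" for g
    using set_nn_integral_carleson_box[OF I] by (simp add: M_def Q_def)
  show ?thesis
  proof (cases "p = 1")
    case True
    define m where "m = ess_inf M (\<lambda>z. ennreal (\<omega> z))"
    have "c < inverse m" using c by (simp add: dual_mean_def True m_def M_def Q_def)
    moreover have "m < top" unfolding m_def M_def Q_def by (rule ess_inf_weight_less_top[OF I])
    moreover have "inverse (inverse c) = c"
      using one_divide_one_divide_ennreal[of c] by (simp add: divide_ennreal_def)
    ultimately have "m < inverse c"
      using ennreal_inverse_antimono[of "inverse c" m] by (auto simp flip: not_le)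
    then obtain m' where m': "m < m'" "m' < inverse c" using dense by blast
    \<comment> \<open>This set has positive measure since \<open>m'\<close> exceeds the essential infimum.\<close>
    define E where "E = {z\<in>Q. ennreal (\<omega> z) < m'}"
    define f where "f = (\<lambda>z. indicator E z :: complex)"
    have EM: "E \<in> sets M" unfolding E_def sp[symmetric] by measurable
    have "E = {z\<in>space (lebesgue_on upper_half_plane). z \<in> Q \<and> ennreal (\<omega> z) < m'}"
      using QU by (auto simp: E_def space_restrict_space)
    also have "\<dots> \<in> sets (lebesgue_on upper_half_plane)" by measurable
    finally have [measurable]: "E \<in> sets (lebesgue_on upper_half_plane)" .
    have E0: "emeasure M E \<noteq> 0"
    proof
      assume "emeasure M E = 0"
      then have "E \<in> null_sets M" using EM by auto
      then have "AE z in M. m' \<le> ennreal (\<omega> z)"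
        by (rule AE_I') (auto simp: E_def sp)
      then have "m' \<le> m" unfolding m_def ess_inf_def by (intro Sup_upper) simp
      then show False using m'(1) by simp
    qed
    have "(\<integral>\<^sup>+z. ennreal (norm (f z)) \<partial>M) = (\<integral>\<^sup>+z. indicator E z \<partial>M)"
      by (intro nn_integral_cong) (auto simp: f_def indicator_def)
    then have mean: "box_mean I f = emeasure M E / V"
      using EM by (simp add: box_average_def int[unfolded Q_def] V_def Q_def)
    have "weighted_integral p \<omega> Q f \<le> (\<integral>\<^sup>+z. m' * indicator E z \<partial>M)"
      unfolding int by (intro nn_integral_mono) (auto simp: f_def True E_def indicator_def)
    then have W: "weighted_integral p \<omega> Q f \<le> m' * emeasure M E"
      using EM by (simp add: nn_integral_cmult_indicator)
    have "emeasure M E \<le> V" using eM emeasure_mono[of E Q lebesgue] Qs by (auto simp: E_def V_def)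
    then have "m' * emeasure M E < top"
      using order_less_le_trans[OF m'(2) top_greatest] V(2)
      by (auto simp: ennreal_mult_less_top top.not_eq_extremum intro: order_le_less_trans)
    then have test: "box_test_function p \<omega> I f"
      unfolding box_test_function_def using W
      by (auto simp: f_def E_def Q_def[symmetric] indicator_def intro!: exI[of _ 1])
    have "c * m' \<le> 1"
    proof (cases "c = 0")
      case True then show ?thesis by simp
    next
      case False
      have "c \<noteq> top" using m'(2) by auto
      have "c * m' \<le> c * inverse c" using m'(2) by (intro mult_left_mono) auto
      also have "c * inverse c = 1"
        using ennreal_divide_self[of c] False \<open>c \<noteq> top\<close>
        by (simp add: divide_ennreal_def top.not_eq_extremum)
      finally show ?thesis .
    qed
    have "c * inverse V * weighted_integral p \<omega> Q f \<le> c * inverse V * (m' * emeasure M E)"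
      by (intro mult_left_mono W) simp
    also have "\<dots> = (c * m') * (emeasure M E / V)" by (simp add: divide_ennreal_def mult_ac)
    also have "\<dots> \<le> 1 * (emeasure M E / V)" by (intro mult_right_mono \<open>c * m' \<le> 1\<close>) simp
    finally have "c * inverse V * weighted_integral p \<omega> Q f \<le> emeasure M E / V" by simp
    moreover have "ennpowr V (- 1) = inverse V" using ennpowr_inverse[of 1 V] by simp
    moreover have "emeasure M E / V \<noteq> 0" using E0 V by simp
    ultimately show ?thesis
      using test mean by (intro exI[of _ f]) (simp add: True V_def Q_def)
  next
    case False
    then have p1: "1 < p" using p by simp
    define p' where "p' = conj_exponent p"
    note p' = conj_exponent_props[OF p1, folded p'_def]
    define \<sigma> where "\<sigma> = (\<lambda>z. ennpowr (ennreal (\<omega> z)) (1 - p'))"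
    define h where "h = (\<lambda>n z. min (of_nat n) (\<sigma> z))"
    define f where "f = (\<lambda>n z. indicator Q z * complex_of_real (enn2real (h n z)))"
    define A where "A = (\<lambda>n. \<integral>\<^sup>+z. h n z \<partial>M)"
    have [measurable]: "\<sigma> \<in> borel_measurable M" "\<sigma> \<in> borel_measurable (lebesgue_on upper_half_plane)"
      by (auto simp: \<sigma>_def)
    have hfin: "h n z < top" for n z by (simp add: h_def min_less_iff_disj of_nat_less_top)
    have fh: "ennreal (norm (f n z)) = h n z" if "z \<in> Q" for n z
      using that hfin[of n z] by (simp add: f_def)
    have "(SUP n. A n) = (\<integral>\<^sup>+z. (SUP n. h n z) \<partial>M)" unfolding A_def
      by (rule nn_integral_monotone_convergence_SUP[symmetric])
        (auto simp: h_def incseq_def le_fun_def min_le_iff_disj intro: min.mono)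
    also have "\<dots> = (\<integral>\<^sup>+z. \<sigma> z \<partial>M)" by (simp add: h_def SUP_min_of_nat)
    finally have "(SUP n. A n) = (\<integral>\<^sup>+z. \<sigma> z \<partial>M)" .
    then have "dual_mean p \<omega> I = ennpowr ((SUP n. A n) / V) (1 / p')"
      using False by (simp add: dual_mean_def box_average_def int[unfolded Q_def] \<sigma>_def p'_def V_def Q_def)
    then have "ennpowr c p' < (SUP n. A n / V)"
      using c p' ennpowr_less_iff(2)[of "1 / p'" c "(SUP n. A n) / V"]
      by (simp add: SUP_divide_ennreal)
    then obtain n where "ennpowr c p' < A n / V" by (auto simp: less_SUP_iff)
    then have n: "c < ennpowr (A n / V) (1 / p')" "A n / V \<noteq> 0"
      using ennpowr_less_iff(1)[of p' c "A n / V"] p' by auto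
    have "(\<integral>\<^sup>+z. ennreal (norm (f n z)) \<partial>M) = A n"
      unfolding A_def by (intro nn_integral_cong) (simp add: fh sp)
    then have mean: "box_mean I (f n) = A n / V"
      by (simp add: box_average_def int[unfolded Q_def] V_def Q_def)
    have "A n \<le> (\<integral>\<^sup>+z. of_nat n \<partial>M)" unfolding A_def h_def by (intro nn_integral_mono) simp
    also have "\<dots> = of_nat n * V" using eM[of Q] sp by (simp add: V_def)
    also have "\<dots> < top" using V by (simp add: ennreal_mult_less_top top.not_eq_extremum of_nat_less_top)
    finally have A: "A n < top" .
    have W: "weighted_integral p \<omega> Q (f n) \<le> A n"
      unfolding int A_def
    proof (rule nn_integral_mono)
      fix z assume "z \<in> space M"
      then have z: "z \<in> Q" using sp by simp
      define t where "t = norm (f n z)"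
      \<comment> \<open>As \<open>(1 - p') * (p - 1) = - 1\<close>, a value \<open>t \<le> \<omega> z powr (1 - p')\<close> satisfies \<open>t powr (p - 1) * \<omega> z \<le> 1\<close>.\<close>
      have "t powr p * \<omega> z \<le> t"
      proof (cases "\<omega> z = 0 \<or> t = 0")
        case True then show ?thesis by (auto simp: t_def)
      next
        case False
        then have w: "0 < \<omega> z" and t: "0 < t" using wpos[OF z] by (auto simp: t_def)
        have "ennreal t \<le> \<sigma> z" using fh[OF z] by (simp add: t_def h_def)
        then have "t \<le> \<omega> z powr (1 - p')" using w by (simp add: \<sigma>_def ennpowr_ennreal)
        then have "t powr (p - 1) \<le> (\<omega> z powr (1 - p')) powr (p - 1)"
          using p1 t by (intro powr_mono2) auto
        also have "\<dots> = inverse (\<omega> z)"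
          using w by (simp add: powr_powr p'(4) powr_minus)
        finally have "t powr (p - 1) * \<omega> z \<le> inverse (\<omega> z) * \<omega> z"
          using w by (intro mult_right_mono) auto
        then have "t * (t powr (p - 1) * \<omega> z) \<le> t" using w t by simp
        then show ?thesis using t powr_add[of t 1 "p - 1"] by (simp add: mult_ac)
      qed
      then have "ennreal (t powr p * \<omega> z) \<le> ennreal t" by (rule ennreal_leI)
      then show "ennreal (norm (f n z) powr p * \<omega> z) \<le> h n z"
        using fh[OF z] by (simp add: t_def)
    qed
    have bound: "norm (f n z) \<le> real n" for z
    proof -
      have "enn2real (h n z) \<le> enn2real (of_nat n)"
        by (intro enn2real_mono) (auto simp: h_def of_nat_less_top)
      then show ?thesis by (auto simp: f_def indicator_def)
    qed
    have "f n \<in> borel_measurable (lebesgue_on upper_half_plane)"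
      unfolding f_def h_def by measurable
    then have test: "box_test_function p \<omega> I (f n)"
      unfolding box_test_function_def using W A bound
      by (auto simp: f_def Q_def[symmetric])
    have "c * ennpowr V (- (1 / p)) * ennpowr (weighted_integral p \<omega> Q (f n)) (1 / p) \<le>
        ennpowr (A n / V) (1 / p') * ennpowr V (- (1 / p)) * ennpowr (A n) (1 / p)"
      by (intro mult_mono[OF mult_mono[OF less_imp_le[OF n(1)] order_refl] ennpowr_mono] W)
        (use p1 in auto)
    also have "\<dots> = ennpowr (A n / V) (1 / p') * ennpowr (A n / V) (1 / p)"
      using p1 ennpowr_inverse[of "1/p" V] by (simp add: divide_ennreal_def ennpowr_mult mult_ac)
    also have "\<dots> = A n / V"
    proof -
      have "A n / V \<noteq> top" using A V by (auto simp: ennreal_divide_eq_top_iff)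
      then show ?thesis
        using n(2) ennpowr_add[of "A n / V" "1 / p'" "1 / p"] p'(2) by (simp add: add.commute)
    qed
    finally show ?thesis
      using test n(2) mean by (intro exI[of _ "f n"]) (simp add: V_def Q_def)
  qed
qed

section \<open>Testing on boxes and bounds on averages\<close>

text \<open>Insert almost extremal test functions for every level below the dual mean and cancel the integral.
  If the integral vanishes, the hypothesis itself forces the box to have measure \<open>0\<close>, since the average
  does not vanish.\<close>

lemma box_testing_conditionI:
  assumes p: "1 \<le> p" and q: "1 \<le> q" and \<omega>: "weight \<omega>" and D: "0 < D"
    and test: "\<And>I f. bdd_interval I \<Longrightarrow> box_test_function p \<omega> I f \<Longrightarrow>
      ennpowr (box_mean I f) q * emeasure \<mu> (carleson_box I) \<le>
      ennreal D * ennpowr (weighted_integral p \<omega> (carleson_box I) f) (q / p)"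
  shows "box_testing_condition p q \<omega> \<mu>"
  unfolding box_testing_condition_def
proof (intro exI[of _ D] conjI D allI impI)
  fix I assume I: "bdd_interval I"
  define V m where "V = emeasure lebesgue (carleson_box I)" and "m = emeasure \<mu> (carleson_box I)"
  have qp: "0 < q" "0 < q / p" "0 < p" using p q by auto
  have "ennpowr (dual_mean p \<omega> I) q * (ennpowr V (- (q / p)) * m) \<le> ennreal D"
  proof (rule le_mult_if_less)
    fix x assume "x < ennpowr (dual_mean p \<omega> I) q"
    then have "ennpowr x (1 / q) < dual_mean p \<omega> I" using ennpowr_less_iff(2)[OF qp(1)] by simp
    then obtain f where f: "box_test_function p \<omega> I f" "box_mean I f \<noteq> 0"
      and le: "ennpowr x (1 / q) * ennpowr V (- (1 / p)) *
        ennpowr (weighted_integral p \<omega> (carleson_box I) f) (1 / p) \<le> box_mean I f"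
      using exists_box_test_function[OF p \<omega> I] unfolding V_def by blast
    define W where "W = weighted_integral p \<omega> (carleson_box I) f"
    have W: "W \<noteq> top" using f(1) by (auto simp: W_def box_test_function_def)
    have "ennpowr (ennpowr x (1 / q) * ennpowr V (- (1 / p)) * ennpowr W (1 / p)) q \<le>
        ennpowr (box_mean I f) q"
      unfolding W_def by (intro ennpowr_mono le qp)
    then have "x * ennpowr V (- (q / p)) * ennpowr W (q / p) \<le> ennpowr (box_mean I f) q"
      using qp by (simp add: ennpowr_mult ennpowr_ennpowr)
    then have "x * ennpowr V (- (q / p)) * ennpowr W (q / p) * m \<le> ennpowr (box_mean I f) q * m"
      by (rule mult_right_mono) simp
    also have "\<dots> \<le> ennreal D * ennpowr W (q / p)"
      using test[OF I f(1)] by (simp add: m_def W_def)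
    finally have *: "x * ennpowr V (- (q / p)) * ennpowr W (q / p) * m \<le> ennreal D * ennpowr W (q / p)" .
    show "x * (ennpowr V (- (q / p)) * m) \<le> ennreal D"
    proof (cases "W = 0")
      case True
      then have "ennpowr (box_mean I f) q * m = 0"
        using test[OF I f(1)] qp by (simp add: m_def W_def)
      then have "m = 0" using f(2) qp by (simp add: ennpowr_eq_0_iff)
      then show ?thesis by simp
    next
      case False
      have "ennpowr W (q / p) * (x * (ennpowr V (- (q / p)) * m)) \<le> ennpowr W (q / p) * ennreal D"
        using * by (simp add: mult_ac)
      then show ?thesis
        using ennpowr_pos_finite[OF False W] by (simp add: ennreal_mult_le_mult_iff)
    qed
  qed
  then show "ennpowr (emeasure lebesgue (carleson_box I)) (- (q / p)) * ennpowr (dual_mean p \<omega> I) q *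
      emeasure \<mu> (carleson_box I) \<le> ennreal D"
    by (simp add: V_def m_def mult_ac)
qed

lemma box_test_function_locally_integrable:
  assumes "box_test_function p \<omega> I f"
  shows "locally_integrable f"
  unfolding locally_integrable_def
proof (intro allI impI)
  fix K assume K: "compact K \<and> K \<subseteq> upper_half_plane"
  have f: "f \<in> borel_measurable (lebesgue_on upper_half_plane)"
    using assms by (simp add: box_test_function_def)
  obtain B where B: "\<And>z. norm (f z) \<le> B" using assms by (auto simp: box_test_function_def)
  have Kl: "K \<in> lmeasurable" using K by (simp add: lmeasurable_compact)
  show "f absolutely_integrable_on K"
  proof (rule measurable_bounded_by_integrable_imp_absolutely_integrable)
    show "f \<in> borel_measurable (lebesgue_on K)" using measurable_restrict_mono[OF f] K by blast
    show "(\<lambda>z. B) integrable_on K" using Kl by (rule integrable_on_const)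
  qed (use Kl B in auto)
qed

lemma box_average_bound_imp_box_testing_condition:
  assumes "1 \<le> p" "1 \<le> q" "weight \<omega>" "box_average_bound p q \<omega> \<mu>"
  shows "box_testing_condition p q \<omega> \<mu>"
proof -
  obtain C where "0 < C" and "\<And>(f :: complex \<Rightarrow> complex) I. locally_integrable f \<Longrightarrow> bdd_interval I \<Longrightarrow>
      ennpowr (box_mean I f) q * emeasure \<mu> (carleson_box I) \<le>
      ennreal C * ennpowr (weighted_integral p \<omega> (carleson_box I) f) (q / p)"
    using assms(4) unfolding box_average_bound_def by blast
  then show ?thesis
    using box_testing_conditionI[OF assms(1-3)] box_test_function_locally_integrable by blast
qed

lemma sets_upper_half_plane_measureI:
  assumes "sets \<mu> = sets (restrict_space borel upper_half_plane)" "S \<in> sets borel" "S \<subseteq> upper_half_plane"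
  shows "S \<in> sets \<mu>"
  using assms by (auto simp: sets_restrict_space image_iff intro!: bexI[of _ S])

text \<open>The bound on averages in the form that the weak type bound consumes, for all measurable functions: a
  function in the weighted space need not be locally integrable, because the weight may vanish.\<close>

lemma box_testing_condition_imp_measurable_box_bound:
  assumes p: "1 \<le> p" and q: "1 \<le> q" and \<omega>: "weight \<omega>" and "box_testing_condition p q \<omega> \<mu>"
  obtains C where "0 < C" "\<And>(f :: complex \<Rightarrow> complex) I. f \<in> borel_measurable (lebesgue_on upper_half_plane) \<Longrightarrow> bdd_interval I \<Longrightarrow>
      ennpowr (box_mean I f) q * emeasure \<mu> (carleson_box I) \<le>
      ennreal C * ennpowr (weighted_integral p \<omega> (carleson_box I) f) (q / p)"
proof -
  obtain C where C: "0 < C" and le: "\<And>I. bdd_interval I \<Longrightarrow>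
      ennpowr (emeasure lebesgue (carleson_box I)) (- (q / p)) * ennpowr (dual_mean p \<omega> I) q *
        emeasure \<mu> (carleson_box I) \<le> ennreal C"
    using assms(4) unfolding box_testing_condition_def by blast
  show thesis
  proof (rule that[OF C])
    fix f :: "complex \<Rightarrow> complex" and I assume f: "f \<in> borel_measurable (lebesgue_on upper_half_plane)" and I: "bdd_interval I"
    define V m where "V = emeasure lebesgue (carleson_box I)" and "m = emeasure \<mu> (carleson_box I)"
    define W where "W = weighted_integral p \<omega> (carleson_box I) f"
    have V: "V \<noteq> 0" "V \<noteq> top" using emeasure_carleson_box_pos_finite[OF I] by (auto simp: V_def)
    have qp: "0 < q" "0 < p" using p q by auto
    show "ennpowr (box_mean I f) q * m \<le> ennreal C * ennpowr W (q / p)"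
    proof (cases "dual_mean p \<omega> I = top")
      case True
      \<comment> \<open>An infinite dual mean is compatible with the testing condition only on a \<open>\<mu>\<close>-null box.\<close>
      have "m = 0"
      proof (rule ccontr)
        assume "m \<noteq> 0"
        then have "ennpowr V (- (q / p)) * ennpowr (dual_mean p \<omega> I) q * m = top"
          using ennpowr_pos_finite[OF V] qp by (simp add: True)
        then show False using le[OF I] by (simp add: V_def m_def top_unique)
      qed
      then show ?thesis by simp
    next
      case False
      have "ennpowr (box_mean I f) q \<le>
          ennpowr (ennpowr V (- (1 / p)) * dual_mean p \<omega> I * ennpowr W (1 / p)) q"
        unfolding V_def W_def by (intro ennpowr_mono box_mean_le_dual_mean p \<omega> I f False qp)
      also have "\<dots> = ennpowr V (- (q / p)) * ennpowr (dual_mean p \<omega> I) q * ennpowr W (q / p)"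
        using qp by (simp add: ennpowr_mult ennpowr_ennpowr)
      finally have "ennpowr (box_mean I f) q * m \<le>
          ennpowr V (- (q / p)) * ennpowr (dual_mean p \<omega> I) q * ennpowr W (q / p) * m"
        by (rule mult_right_mono) simp
      also have "\<dots> = (ennpowr V (- (q / p)) * ennpowr (dual_mean p \<omega> I) q * m) * ennpowr W (q / p)"
        by (simp add: mult_ac)
      also have "\<dots> \<le> ennreal C * ennpowr W (q / p)"
        using le[OF I] by (intro mult_right_mono) (simp_all add: V_def m_def)
      finally show ?thesis .
    qed
  qed
qed

lemma box_testing_condition_imp_box_average_bound:
  assumes "1 \<le> p" "1 \<le> q" "weight \<omega>" "box_testing_condition p q \<omega> \<mu>"
  shows "box_average_bound p q \<omega> \<mu>"
proof -
  obtain C where "0 < C" "\<And>(f :: complex \<Rightarrow> complex) I. f \<in> borel_measurable (lebesgue_on upper_half_plane) \<Longrightarrow> bdd_interval I \<Longrightarrow>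
      ennpowr (box_mean I f) q * emeasure \<mu> (carleson_box I) \<le>
      ennreal C * ennpowr (weighted_integral p \<omega> (carleson_box I) f) (q / p)"
    using box_testing_condition_imp_measurable_box_bound[OF assms] by blast
  then show ?thesis
    unfolding box_average_bound_def
    by (intro exI[of _ C]) (auto dest: locally_integrable_imp_borel_measurable)
qed

section \<open>The weak type bound\<close>

text \<open>If the average over a box exceeds \<open>l\<close>, the whole box lies in the superlevel set. Letting \<open>l\<close> increase to the
  average turns the weak type bound into the bound on averages for test functions.\<close>

lemma weak_type_bound_imp_box_testing_condition:
  assumes p: "1 \<le> p" and q: "1 \<le> q" and \<omega>: "weight \<omega>"
    and \<mu>: "sets \<mu> = sets (restrict_space borel upper_half_plane)"
    and weak: "weak_type_bound p q \<omega> \<mu>"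
  shows "box_testing_condition p q \<omega> \<mu>"
proof -
  obtain C where C: "0 < C" and le: "\<And>f l. f \<in> weighted_Lp p \<omega> \<Longrightarrow> 0 < l \<Longrightarrow>
      emeasure \<mu> {z\<in>upper_half_plane. maximal_fun f z > ennreal l} \<le>
      ennreal (C / l powr q) * ennpowr (weighted_integral p \<omega> upper_half_plane f) (q / p)"
    using weak unfolding weak_type_bound_def by blast
  show ?thesis
  proof (rule box_testing_conditionI[OF p q \<omega> C])
    fix I f assume I: "bdd_interval I" and f: "box_test_function p \<omega> I f"
    define m where "m = emeasure \<mu> (carleson_box I)"
    have f0: "f z = 0" if "z \<notin> carleson_box I" for z using f that by (auto simp: box_test_function_def)
    have W: "weighted_integral p \<omega> upper_half_plane f = weighted_integral p \<omega> (carleson_box I) f"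
      using carleson_box_subset_upper_half_plane[of I] f0
      by (intro nn_integral_cong) (auto simp: indicator_def)
    have Lp: "f \<in> weighted_Lp p \<omega>"
      using f W by (auto simp: weighted_Lp_def box_test_function_def)
    show "ennpowr (box_mean I f) q * m \<le>
        ennreal C * ennpowr (weighted_integral p \<omega> (carleson_box I) f) (q / p)"
    proof (rule le_mult_if_less)
      fix x assume x: "x < ennpowr (box_mean I f) q"
      show "x * m \<le> ennreal C * ennpowr (weighted_integral p \<omega> (carleson_box I) f) (q / p)"
      proof (cases "x = 0")
        case True then show ?thesis by simp
      next
        case False
        then obtain t where t: "x = ennreal t" "0 < t"
          using x by (cases x) (auto simp: less_le top_unique)
        define l where "l = t powr (1 / q)"
        have l: "0 < l" "l powr q = t" using t q by (auto simp: l_def powr_powr)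
        have "ennreal l < box_mean I f"
          using x ennpowr_less_iff(2)[of q] q t by (simp add: ennpowr_ennreal l_def)
        then have "carleson_box I \<subseteq> {z\<in>upper_half_plane. maximal_fun f z > ennreal l}"
          using I carleson_box_subset_upper_half_plane[of I]
          by (auto simp: maximal_fun_def less_SUP_iff)
        moreover have "{z\<in>upper_half_plane. maximal_fun f z > ennreal l} \<in> sets \<mu>"
          using open_maximal_fun_superlevel_set[OF l(1)]
          by (intro sets_upper_half_plane_measureI[OF \<mu>] borel_open) auto
        ultimately have "m \<le> emeasure \<mu> {z\<in>upper_half_plane. maximal_fun f z > ennreal l}"
          unfolding m_def by (rule emeasure_mono)
        also have "\<dots> \<le> ennreal (C / t) * ennpowr (weighted_integral p \<omega> (carleson_box I) f) (q / p)"
          using le[OF Lp l(1)] by (simp add: l W)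
        finally have "x * m \<le> x * (ennreal (C / t) * ennpowr (weighted_integral p \<omega> (carleson_box I) f) (q / p))"
          by (rule mult_left_mono) simp
        also have "x * ennreal (C / t) = ennreal C"
          using t C by (simp flip: ennreal_mult)
        then have "x * (ennreal (C / t) * ennpowr (weighted_integral p \<omega> (carleson_box I) f) (q / p)) =
            ennreal C * ennpowr (weighted_integral p \<omega> (carleson_box I) f) (q / p)"
          by (simp flip: mult.assoc)
        finally show ?thesis .
      qed
    qed
  qed
qed

text \<open>Boxes inherit both disjointness and inclusion from their bases, so the covering lemma is needed only
  for intervals on the line.\<close>

lemma Vitali_carleson_boxes:
  fixes K :: "(real \<times> real) set"
  assumes "finite K" "\<And>x r. (x, r) \<in> K \<Longrightarrow> 0 < r"
  obtains C where "C \<subseteq> K" "disjoint_family_on (\<lambda>(x, r). carleson_box (ball x r)) C"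
    "(\<Union>(x, r)\<in>K. carleson_box (ball x r)) \<subseteq> (\<Union>(x, r)\<in>C. carleson_box (ball x (5 * r)))"
proof -
  \<comment> \<open>The covering lemma needs a uniform bound for the radii; the \<open>1\<close> only covers the empty family.\<close>
  define B where "B = Max (insert 1 (snd ` K))"
  have B: "0 < snd i \<and> snd i \<le> B" if "i \<in> K" for i
    using assms that by (cases i) (force simp: B_def intro: Max_ge)
  obtain C where C: "C \<subseteq> K"
      "pairwise (\<lambda>i j. disjnt (cball (fst i) (snd i)) (cball (fst j) (snd j))) C"
      "\<And>i. i \<in> K \<Longrightarrow> \<exists>j. j \<in> C \<and> \<not> disjnt (cball (fst i) (snd i)) (cball (fst j) (snd j)) \<and>
         cball (fst i) (snd i) \<subseteq> ball (fst j) (5 * snd j)"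
    by (rule Vitali_covering_lemma_cballs_balls[of K snd B fst, OF B]) blast+
  show thesis
  proof (rule that[OF C(1)])
    show "disjoint_family_on (\<lambda>(x, r). carleson_box (ball x r)) C"
      unfolding disjoint_family_on_def
    proof (intro ballI impI)
      fix i j assume "i \<in> C" "j \<in> C" "i \<noteq> j"
      then have "disjnt (cball (fst i) (snd i)) (cball (fst j) (snd j))"
        using C(2) by (auto simp: pairwise_def)
      then have "disjnt (ball (fst i) (snd i)) (ball (fst j) (snd j))"
        using ball_subset_cball disjnt_subset1 disjnt_subset2 by metis
      then show "(case i of (x, r) \<Rightarrow> carleson_box (ball x r)) \<inter>
          (case j of (x, r) \<Rightarrow> carleson_box (ball x r)) = {}"
        using disjoint_carleson_box by (auto simp: case_prod_beta disjnt_def)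
    qed
    show "(\<Union>(x, r)\<in>K. carleson_box (ball x r)) \<subseteq> (\<Union>(x, r)\<in>C. carleson_box (ball x (5 * r)))"
    proof clarify
      fix z x r assume i: "(x, r) \<in> K" "z \<in> carleson_box (ball x r)"
      then obtain y s where j: "(y, s) \<in> C" "cball x r \<subseteq> ball y (5 * s)" using C(3) by fastforce
      have pos: "0 < r" "0 < s" using i j C(1) assms(2) by auto
      have "carleson_box (ball x r) \<subseteq> carleson_box (ball y (5 * s))"
        using pos j(2) ball_subset_cball[of x r] by (intro carleson_box_mono bdd_interval_ball) auto
      then show "z \<in> (\<Union>(x, r)\<in>C. carleson_box (ball x (5 * r)))" using i j by auto
    qed
  qed
qed

text \<open>Additivity of the measure with density \<open>h\<close>.\<close>

lemma sum_carleson_box_integrals_le: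
  assumes h: "h \<in> borel_measurable (lebesgue_on upper_half_plane)"
    and C: "finite C" "disjoint_family_on (\<lambda>i. carleson_box (J i)) C" "\<And>i. i \<in> C \<Longrightarrow> bdd_interval (J i)"
  shows "(\<Sum>i\<in>C. \<integral>\<^sup>+z\<in>carleson_box (J i). h z \<partial>lebesgue) \<le> (\<integral>\<^sup>+z\<in>upper_half_plane. h z \<partial>lebesgue)"
proof -
  let ?M = "lebesgue_on upper_half_plane"
  define \<nu> where "\<nu> = density ?M h"
  have sets: "carleson_box (J i) \<in> sets ?M" if "i \<in> C" for i
    using that C(3) lebesgue_carleson_box carleson_box_subset_upper_half_plane
    by (auto simp: sets_restrict_space image_iff intro!: bexI[of _ "carleson_box (J i)"])
  have "(\<integral>\<^sup>+z\<in>carleson_box (J i). h z \<partial>lebesgue) = emeasure \<nu> (carleson_box (J i))" if "i \<in> C" for i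
  proof -
    have "emeasure \<nu> (carleson_box (J i)) =
        (\<integral>\<^sup>+z. h z * indicator (carleson_box (J i)) z * indicator upper_half_plane z \<partial>lebesgue)"
      using h sets[OF that]
      by (simp add: \<nu>_def emeasure_density nn_integral_restrict_space upper_half_plane_sets)
    also have "\<dots> = (\<integral>\<^sup>+z\<in>carleson_box (J i). h z \<partial>lebesgue)"
      using carleson_box_subset_upper_half_plane[of "J i"]
      by (intro nn_integral_cong) (auto simp: indicator_def)
    finally show ?thesis by simp
  qed
  then have "(\<Sum>i\<in>C. \<integral>\<^sup>+z\<in>carleson_box (J i). h z \<partial>lebesgue) = (\<Sum>i\<in>C. emeasure \<nu> (carleson_box (J i)))"
    by simp
  also have "\<dots> = emeasure \<nu> (\<Union>i\<in>C. carleson_box (J i))"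
    using C sets by (intro sum_emeasure) (auto simp: \<nu>_def)
  also have "\<dots> \<le> emeasure \<nu> (space \<nu>)" by (rule emeasure_space)
  also have "\<dots> = (\<integral>\<^sup>+z\<in>upper_half_plane. h z \<partial>lebesgue)"
    using h by (simp add: \<nu>_def emeasure_density space_restrict_space nn_integral_restrict_space
        upper_half_plane_sets mult.assoc flip: indicator_inter_arith)
  finally show ?thesis .
qed

text \<open>Apply the bound on averages over the box with the fivefold base to \<open>f\<close> restricted to the original box. The
  area grows by the factor \<open>25\<close>, so the average is still above \<open>l / 25\<close>.\<close>

lemma measure_dilated_box_le:
  fixes f :: "complex \<Rightarrow> complex"
  assumes q: "1 \<le> q" and f: "f \<in> borel_measurable (lebesgue_on upper_half_plane)"
    and C: "0 < C" and l: "0 < l" and r: "0 < r" and gt: "ennreal l < box_mean (ball x r) f"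
    and bound: "\<And>(f :: complex \<Rightarrow> complex) I. f \<in> borel_measurable (lebesgue_on upper_half_plane) \<Longrightarrow>
      bdd_interval I \<Longrightarrow> ennpowr (box_mean I f) q * emeasure \<mu> (carleson_box I) \<le>
      ennreal C * ennpowr (weighted_integral p \<omega> (carleson_box I) f) (q / p)"
  shows "emeasure \<mu> (carleson_box (ball x (5 * r))) \<le>
    ennreal (25 powr q * C / l powr q) *
      ennpowr (weighted_integral p \<omega> (carleson_box (ball x r)) f) (q / p)"
proof -
  let ?J = "ball x r" and ?J5 = "ball x (5 * r)"
  have J: "bdd_interval ?J" "bdd_interval ?J5" using r by (auto intro: bdd_interval_ball)
  have sub: "carleson_box ?J \<subseteq> carleson_box ?J5" using r J by (intro carleson_box_mono) auto
  define g where "g = (\<lambda>z. indicator (carleson_box ?J) z * f z)"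
  have "carleson_box ?J \<in> sets (lebesgue_on upper_half_plane)"
    using lebesgue_carleson_box[OF J(1)] carleson_box_subset_upper_half_plane
    by (auto simp: sets_restrict_space image_iff intro!: bexI[of _ "carleson_box ?J"])
  then have g: "g \<in> borel_measurable (lebesgue_on upper_half_plane)"
    using f unfolding g_def by measurable
  have W: "weighted_integral p \<omega> (carleson_box ?J5) g = weighted_integral p \<omega> (carleson_box ?J) f"
    using sub by (intro nn_integral_cong) (auto simp: g_def indicator_def)
  have X: "(\<integral>\<^sup>+z\<in>carleson_box ?J5. ennreal (norm (g z)) \<partial>lebesgue) =
      (\<integral>\<^sup>+z\<in>carleson_box ?J. ennreal (norm (f z)) \<partial>lebesgue)"
    using sub by (intro nn_integral_cong) (auto simp: g_def indicator_def)
  have "emeasure lebesgue (carleson_box ?J5) = ennreal 25 * emeasure lebesgue (carleson_box ?J)"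
    using r measure_ball_real[of r x] measure_ball_real[of "5 * r" x]
    unfolding emeasure_carleson_box[OF J(1)] emeasure_carleson_box[OF J(2)]
    by (simp add: power_mult_distrib numeral_mult_ennreal del: measure_completion)
  then have mean: "box_mean ?J5 g = box_mean ?J f * inverse (ennreal 25)"
    using emeasure_carleson_box_pos_finite[OF J(1)]
    unfolding box_average_def X
    by (simp add: divide_ennreal_def ennreal_inverse_mult top.not_eq_extremum mult_ac)
  have "ennreal (l / 25) = ennreal l * inverse (ennreal 25)"
    unfolding divide_ennreal_def[symmetric] by (rule divide_ennreal[symmetric]) (use l in auto)
  also have "\<dots> \<le> box_mean ?J5 g"
    unfolding mean using gt by (intro mult_right_mono) auto
  finally have "ennpowr (ennreal (l / 25)) q \<le> ennpowr (box_mean ?J5 g) q"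
    using q by (intro ennpowr_mono) auto
  then have "ennreal ((l / 25) powr q) * emeasure \<mu> (carleson_box ?J5) \<le>
      ennpowr (box_mean ?J5 g) q * emeasure \<mu> (carleson_box ?J5)"
    using l by (intro mult_right_mono) (simp_all add: ennpowr_ennreal)
  also have "\<dots> \<le> ennreal C * ennpowr (weighted_integral p \<omega> (carleson_box ?J) f) (q / p)"
    using bound[OF g J(2)] by (simp add: W)
  finally have "ennreal ((25 / l) powr q) * (ennreal ((l / 25) powr q) * emeasure \<mu> (carleson_box ?J5)) \<le>
      ennreal ((25 / l) powr q) * (ennreal C * ennpowr (weighted_integral p \<omega> (carleson_box ?J) f) (q / p))"
    by (rule mult_left_mono) simp
  moreover have "ennreal ((25 / l) powr q) * ennreal ((l / 25) powr q) = 1"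
    using l by (simp flip: ennreal_mult powr_mult)
  moreover have "ennreal ((25 / l) powr q) * ennreal C = ennreal (25 powr q * C / l powr q)"
    using l C by (simp add: powr_divide flip: ennreal_mult)
  ultimately show ?thesis by (simp flip: mult.assoc)
qed

text \<open>The estimate for finite unions of boxes comes from Vitali's lemma; the whole superlevel set is an
  increasing union of such finite unions, because a countable subfamily of the open boxes suffices.\<close>

lemma box_testing_condition_imp_weak_type_bound:
  assumes p: "1 \<le> p" and q: "1 \<le> q" and pq: "p \<le> q" and \<omega>: "weight \<omega>"
    and \<mu>: "sets \<mu> = sets (restrict_space borel upper_half_plane)"
    and "box_testing_condition p q \<omega> \<mu>"
  shows "weak_type_bound p q \<omega> \<mu>"
proof -
  obtain C where C: "0 < C" and bound: "\<And>(f :: complex \<Rightarrow> complex) I.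
      f \<in> borel_measurable (lebesgue_on upper_half_plane) \<Longrightarrow> bdd_interval I \<Longrightarrow>
      ennpowr (box_mean I f) q * emeasure \<mu> (carleson_box I) \<le>
      ennreal C * ennpowr (weighted_integral p \<omega> (carleson_box I) f) (q / p)"
    using box_testing_condition_imp_measurable_box_bound[OF p q \<omega> assms(6)] by blast
  have s: "1 \<le> q / p" using p pq by simp
  have box_sets: "carleson_box (ball x r) \<in> sets \<mu>" if "0 < r" for x r
    by (intro sets_upper_half_plane_measureI[OF \<mu>] borel_carleson_box bdd_interval_ball that
        carleson_box_subset_upper_half_plane)
  show ?thesis
    unfolding weak_type_bound_def
  proof (intro exI[of _ "25 powr q * C"] conjI ballI allI impI)
    show "0 < 25 powr q * C" using C by simp
    fix f and l :: real assume Lp: "f \<in> weighted_Lp p \<omega>" and l: "0 < l"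
    have f: "f \<in> borel_measurable (lebesgue_on upper_half_plane)" using Lp by (simp add: weighted_Lp_def)
    define D where "D = ennreal (25 powr q * C / l powr q)"
    define W where "W = weighted_integral p \<omega> upper_half_plane f"
    define K where "K = {(x :: real, r). 0 < r \<and> ennreal l < box_mean (ball x r) f}"
    define box where "box = (\<lambda>(x :: real, r). carleson_box (ball x r))"
    have h: "(\<lambda>z. ennreal (norm (f z) powr p * \<omega> z)) \<in> borel_measurable (lebesgue_on upper_half_plane)"
      using f weight_measurable[OF \<omega>] by measurable
    have le_finite_union: "emeasure \<mu> (\<Union>i\<in>F. box i) \<le> D * ennpowr W (q / p)"
      if F: "finite F" "F \<subseteq> K" for F
    proof -
      have Fpos: "0 < r" if "(x, r) \<in> F" for x r using that F(2) by (auto simp: K_def)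
      obtain E where E: "E \<subseteq> F" "disjoint_family_on box E"
          "(\<Union>i\<in>F. box i) \<subseteq> (\<Union>(x, r)\<in>E. carleson_box (ball x (5 * r)))"
        unfolding box_def by (rule Vitali_carleson_boxes[OF F(1) Fpos]) blast+
      have finE: "finite E" using E(1) F(1) finite_subset by blast
      have Epos: "0 < snd i" if "i \<in> E" for i using that E(1) Fpos by (cases i) auto
      have "emeasure \<mu> (\<Union>i\<in>F. box i) \<le> emeasure \<mu> (\<Union>i\<in>E. carleson_box (ball (fst i) (5 * snd i)))"
        using E(3) finE Epos by (intro emeasure_mono) (auto simp: case_prod_beta intro!: box_sets)
      also have "\<dots> \<le> (\<Sum>i\<in>E. emeasure \<mu> (carleson_box (ball (fst i) (5 * snd i))))"
        using finE Epos by (intro emeasure_subadditive_finite) (auto intro!: box_sets)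
      also have "\<dots> \<le> (\<Sum>i\<in>E. D * ennpowr (weighted_integral p \<omega> (carleson_box (ball (fst i) (snd i))) f) (q / p))"
      proof (intro sum_mono)
        fix i assume i: "i \<in> E"
        then have "ennreal l < box_mean (ball (fst i) (snd i)) f"
          using E(1) F(2) by (auto simp: K_def)
        then show "emeasure \<mu> (carleson_box (ball (fst i) (5 * snd i))) \<le>
            D * ennpowr (weighted_integral p \<omega> (carleson_box (ball (fst i) (snd i))) f) (q / p)"
          unfolding D_def by (rule measure_dilated_box_le[OF q f C l Epos[OF i] _ bound])
      qed
      also have "\<dots> = D * (\<Sum>i\<in>E. ennpowr (weighted_integral p \<omega> (carleson_box (ball (fst i) (snd i))) f) (q / p))"
        by (simp add: sum_distrib_left)
      also have "\<dots> \<le> D * ennpowr (\<Sum>i\<in>E. weighted_integral p \<omega> (carleson_box (ball (fst i) (snd i))) f) (q / p)"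
        by (intro mult_left_mono sum_ennpowr_le finE s) simp
      also have "\<dots> \<le> D * ennpowr W (q / p)"
      proof (intro mult_left_mono ennpowr_mono)
        show "(\<Sum>i\<in>E. weighted_integral p \<omega> (carleson_box (ball (fst i) (snd i))) f) \<le> W"
          unfolding W_def using finE E(2) Epos
          by (intro sum_carleson_box_integrals_le[OF h] bdd_interval_ball)
            (simp_all add: box_def case_prod_unfold)
      qed (use s in auto)
      finally show ?thesis .
    qed
    have eq: "{z\<in>upper_half_plane. ennreal l < maximal_fun f z} = (\<Union>i\<in>K. box i)"
      unfolding maximal_fun_superlevel_set[OF l] K_def box_def ..
    have "\<And>S. S \<in> box ` K \<Longrightarrow> open S" by (auto simp: box_def intro: open_carleson_box)
    then obtain \<F> where "\<F> \<subseteq> box ` K" "countable \<F>" "\<Union>\<F> = (\<Union>i\<in>K. box i)"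
      by (rule Lindelof)
    then obtain K' where K': "countable K'" "K' \<subseteq> K" "(\<Union>i\<in>K'. box i) = (\<Union>i\<in>K. box i)"
      by (metis countable_subset_image)
    have "emeasure \<mu> (\<Union>i\<in>K'. box i) \<le> D * ennpowr W (q / p)"
    proof (cases "K' = {}")
      case True then show ?thesis by simp
    next
      case False
      define G where "G = (\<lambda>n. \<Union>i\<in>from_nat_into K' ` {..n}. box i)"
      have in_K: "from_nat_into K' n \<in> K" for n using from_nat_into[OF False] K'(2) by blast
      have "(\<Union>n. G n) = (\<Union>i\<in>K'. box i)"
      proof -
        have "(\<Union>n. G n) = (\<Union>i\<in>range (from_nat_into K'). box i)" unfolding G_def by blast
        then show ?thesis by (simp only: range_from_nat_into[OF False K'(1)])
      qed
      moreover have "box i \<in> sets \<mu>" if "i \<in> K" for i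
        using that box_sets by (auto simp: box_def K_def)
      then have "range G \<subseteq> sets \<mu>"
        unfolding G_def using in_K by (intro image_subsetI sets.finite_UN) (simp, blast)
      then have "(SUP n. emeasure \<mu> (G n)) = emeasure \<mu> (\<Union>n. G n)"
        by (intro SUP_emeasure_incseq) (auto simp: G_def incseq_def intro: order_trans)
      moreover have "emeasure \<mu> (G n) \<le> D * ennpowr W (q / p)" for n
        unfolding G_def using in_K by (intro le_finite_union) auto
      ultimately show ?thesis by (metis SUP_least)
    qed
    then show "emeasure \<mu> {z\<in>upper_half_plane. ennreal l < maximal_fun f z} \<le>
        ennreal (25 powr q * C / l powr q) * ennpowr (weighted_integral p \<omega> upper_half_plane f) (q / p)"
      unfolding eq K'(3) D_def W_def .
  qed
qed

theorem theorem1p3: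
  fixes p q :: real and \<omega> :: "complex \<Rightarrow> real" and \<mu> :: "complex measure"
  assumes "1 \<le> p" and "1 \<le> q"
    and "weight \<omega>"
    and "sets \<mu> = sets (restrict_space borel upper_half_plane)"
  shows "(p \<le> q \<longrightarrow> (weak_type_bound p q \<omega> \<mu> \<longleftrightarrow> box_testing_condition p q \<omega> \<mu>)) \<and>
         (box_testing_condition p q \<omega> \<mu> \<longleftrightarrow> box_average_bound p q \<omega> \<mu>) \<and>
         (weak_type_bound p q \<omega> \<mu> \<longrightarrow> box_testing_condition p q \<omega> \<mu>)"
  using weak_type_bound_imp_box_testing_condition[OF assms]
    box_testing_condition_imp_weak_type_bound[OF assms(1,2) _ assms(3,4)]
    box_testing_condition_imp_box_average_bound[OF assms(1-3)]
    box_average_bound_imp_box_testing_condition[OF assms(1-3)]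
  by blast

end
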